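(* Let $p$ be an odd prime, $S$ a finite $p$-group, and $D\trianglelefteq S$. Then each of the sets $\mathcal{A}_o(D)$, $\mathcal{A}_r(D)$, $\mathcal{A}_e(D)$, $\mathcal{A}_{\mathrm{lex}}(D)$, $\mathcal{A}_{\mathrm{olex}}(D)$ and $\mathcal{A}_{O,E,\zeta}(D)$ (for any fixed integers $O,E$ and any fixed sequence of integers $\zeta=(\zeta_1,\zeta_2,\dots)$) has the replacement property in $S$.
   Context: All groups are finite. A set $\mathcal{A}$ of abelian subgroups of $S$ has the replacement property in $S$ if: for every $B\trianglelefteq S$ of nilpotency class $\leq 2$, if there exist members of $\mathcal{A}$ that contain $[B,B]$ but do not contain $B$, then $B$ normalizes one of them (that is, $B$ normalizes some member of $\mathcal{A}$ that contains $[B,B]$ but not $B$). For a $p$-group $D$, $\mathfrak{Ab}(D)$ is the set of abelian subgroups of $D$. The rank of an abelian group is the size of its smallest generating set; the rank of a nonabelian $p$-group is the maximum of the ranks of its abelian subgroups. $\Omega_i(P)$ is the subgroup of a $p$-group $P$ generated by all elements of order $\leq p^i$, and for an abelian $p$-group $A$, $\omega_i(A):=|\Omega_i(A)|$. For sequences of integers, $\geq_{\mathrm{lex}}$ is the usual lexicographic order; when an abelian $p$-group $A$ appears on one side of $\geq_{\mathrm{lex}}$, it stands for the sequence $(\omega_1(A),\omega_2(A),\dots)$. Define: $\mathcal{A}_o(D)=\{A\in\mathfrak{Ab}(D): |A|\geq|A'|\text{ for all }A'\in\mathfrak{Ab}(D)\}$; $\mathcal{A}_r(D)=\{A\in\mathfrak{Ab}(D):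 \mathrm{rank}(A)=\mathrm{rank}(D)\}$; $\mathcal{A}_e(D)=\{A\in\mathcal{A}_r(D): A\text{ is elementary abelian}\}$; $\mathcal{A}_{\mathrm{lex}}(D)=\{A\in\mathfrak{Ab}(D): A\geq_{\mathrm{lex}}A'\text{ for all }A'\in\mathfrak{Ab}(D)\}$; $\mathcal{A}_{\mathrm{olex}}(D)=\{A\in\mathcal{A}_o(D): A\geq_{\mathrm{lex}}A'\text{ for all }A'\in\mathcal{A}_o(D)\}$; $\mathcal{A}_{O,E,\zeta}(D)=\{A\in\mathfrak{Ab}(D): |A|=p^O,\ \mathrm{exponent}(A)\leq p^E,\ A\geq_{\mathrm{lex}}\zeta\}$. *)

theory Defs
  imports
    "HOL-Algebra.Algebra"
    "HOL-Library.Fun_Lexorder"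
begin

text \<open>
  Subgroups are subsets of the carrier of an ambient group \<open>G\<close>. The group formed by a
  subgroup \<open>H\<close> is \<open>G\<lparr>carrier := H\<rparr>\<close>.
\<close>

definition commutator_subgroup :: "('a, 'b) monoid_scheme \<Rightarrow> 'a set \<Rightarrow> 'a set \<Rightarrow> 'a set" where
  "commutator_subgroup G H K =
     generate G {h \<otimes>\<^bsub>G\<^esub> k \<otimes>\<^bsub>G\<^esub> inv\<^bsub>G\<^esub> h \<otimes>\<^bsub>G\<^esub> inv\<^bsub>G\<^esub> k | h k. h \<in> H \<and> k \<in> K}"

text \<open>The numbering starts at \<open>0\<close>: the \<open>c\<close>-th term is what is usually written \<open>\<gamma>\<close> with index \<open>c + 1\<close>.\<close>

fun lower_central_series :: "('a, 'b) monoid_scheme \<Rightarrow> 'a set \<Rightarrow> nat \<Rightarrow> 'a set" where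
  "lower_central_series G B 0 = B"
| "lower_central_series G B (Suc c) = commutator_subgroup G (lower_central_series G B c) B"

definition nilpotency_class_le :: "('a, 'b) monoid_scheme \<Rightarrow> 'a set \<Rightarrow> nat \<Rightarrow> bool" where
  "nilpotency_class_le G B c \<longleftrightarrow> lower_central_series G B c = {\<one>\<^bsub>G\<^esub>}"

definition abelian_subgroups :: "('a, 'b) monoid_scheme \<Rightarrow> 'a set \<Rightarrow> 'a set set" where
  "abelian_subgroups G D =
     {A. subgroup A (G\<lparr>carrier := D\<rparr>) \<and> comm_group (G\<lparr>carrier := A\<rparr>)}"

text \<open>\<open>derived G B\<close> is \<open>[B, B]\<close>.\<close>

definition replacement_property :: "('a, 'b) monoid_scheme \<Rightarrow> 'a set set \<Rightarrow> bool" where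
  "replacement_property S \<A> \<longleftrightarrow>
     \<A> \<subseteq> abelian_subgroups S (carrier S) \<and>
     (\<forall>B. B \<lhd> S \<longrightarrow> nilpotency_class_le S B 2 \<longrightarrow>
        (\<exists>A\<in>\<A>. derived S B \<subseteq> A \<and> \<not> B \<subseteq> A) \<longrightarrow>
        (\<exists>A\<in>\<A>. derived S B \<subseteq> A \<and> \<not> B \<subseteq> A \<and> B \<subseteq> normalizer S A))"

definition min_generators :: "('a, 'b) monoid_scheme \<Rightarrow> 'a set \<Rightarrow> nat" where
  "min_generators G A = (LEAST n. \<exists>Y. Y \<subseteq> A \<and> finite Y \<and> card Y = n \<and> generate G Y = A)"

definition group_rank :: "('a, 'b) monoid_scheme \<Rightarrow> 'a set \<Rightarrow> nat" where
  "group_rank G P =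
     (if comm_group (G\<lparr>carrier := P\<rparr>) then min_generators G P
      else Max (min_generators G ` abelian_subgroups G P))"

definition group_exponent :: "('a, 'b) monoid_scheme \<Rightarrow> 'a set \<Rightarrow> nat" where
  "group_exponent G A = (LEAST n. 0 < n \<and> (\<forall>x\<in>A. x [^]\<^bsub>G\<^esub> n = \<one>\<^bsub>G\<^esub>))"

definition elementary_abelian :: "('a, 'b) monoid_scheme \<Rightarrow> nat \<Rightarrow> 'a set \<Rightarrow> bool" where
  "elementary_abelian G p A \<longleftrightarrow>
     comm_group (G\<lparr>carrier := A\<rparr>) \<and> (\<forall>x\<in>A. x [^]\<^bsub>G\<^esub> p = \<one>\<^bsub>G\<^esub>)"

definition Omega :: "('a, 'b) monoid_scheme \<Rightarrow> nat \<Rightarrow> nat \<Rightarrow> 'a set \<Rightarrow> 'a set" where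
  "Omega G p i P = generate G {x \<in> P. group.ord G x \<le> p ^ i}"

text \<open>
  Sequences \<open>(s\<^sub>1, s\<^sub>2, \<dots>)\<close> of integers are functions \<open>s :: nat \<Rightarrow> int\<close> where \<open>s i\<close> is the
  entry with index \<open>i + 1\<close>. So \<open>omega_seq\<close> starts with the order of \<open>Omega G p 1 A\<close>.
\<close>

definition omega_seq :: "('a, 'b) monoid_scheme \<Rightarrow> nat \<Rightarrow> 'a set \<Rightarrow> nat \<Rightarrow> int" where
  "omega_seq G p A = (\<lambda>i. int (card (Omega G p (Suc i) A)))"

definition lex_ge :: "(nat \<Rightarrow> int) \<Rightarrow> (nat \<Rightarrow> int) \<Rightarrow> bool" where
  "lex_ge s t \<longleftrightarrow> s = t \<or> less_fun t s"

definition A_o :: "('a, 'b) monoid_scheme \<Rightarrow> 'a set \<Rightarrow> 'a set set" where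
  "A_o G D = {A \<in> abelian_subgroups G D. \<forall>A'\<in>abelian_subgroups G D. card A \<ge> card A'}"

definition A_r :: "('a, 'b) monoid_scheme \<Rightarrow> 'a set \<Rightarrow> 'a set set" where
  "A_r G D = {A \<in> abelian_subgroups G D. group_rank G A = group_rank G D}"

definition A_e :: "('a, 'b) monoid_scheme \<Rightarrow> nat \<Rightarrow> 'a set \<Rightarrow> 'a set set" where
  "A_e G p D = {A \<in> A_r G D. elementary_abelian G p A}"

definition A_lex :: "('a, 'b) monoid_scheme \<Rightarrow> nat \<Rightarrow> 'a set \<Rightarrow> 'a set set" where
  "A_lex G p D = {A \<in> abelian_subgroups G D.
     \<forall>A'\<in>abelian_subgroups G D. lex_ge (omega_seq G p A) (omega_seq G p A')}"

definition A_olex :: "('a, 'b) monoid_scheme \<Rightarrow> nat \<Rightarrow> 'a set \<Rightarrow> 'a set set" where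
  "A_olex G p D = {A \<in> A_o G D. \<forall>A'\<in>A_o G D. lex_ge (omega_seq G p A) (omega_seq G p A')}"

text \<open>
  The parameters \<open>m\<close> and \<open>e\<close> (the numbers \<open>O\<close> and \<open>E\<close> of \<open>\<A>\<^bsub>O,E,\<zeta>\<^esub>(D)\<close>) are arbitrary integers,
  so the powers are taken in \<open>real\<close>; for negative \<open>m\<close> or \<open>e\<close> the set is empty.
\<close>

definition A_param :: "('a, 'b) monoid_scheme \<Rightarrow> nat \<Rightarrow> int \<Rightarrow> int \<Rightarrow> (nat \<Rightarrow> int) \<Rightarrow> 'a set \<Rightarrow> 'a set set" where
  "A_param G p m e \<zeta> D = {A \<in> abelian_subgroups G D.
     real (card A) = real p powi m \<and> real (group_exponent G A) \<le> real p powi e \<and>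
     lex_ge (omega_seq G p A) \<zeta>}"

end

theory Submission
  imports Defs
begin

text \<open>
  Write \<open>a\<^sup>b = b a b\<^sup>-\<^sup>1\<close>. Among the members of the family that contain \<open>[B, B]\<close> but not \<open>B\<close> take \<open>A\<close> with
  \<open>|A \<inter> B|\<close> maximal. If \<open>B\<close> does not normalize \<open>A\<close>, choose \<open>b \<in> B\<close> not normalizing \<open>A\<close> but central
  modulo a normal subgroup of \<open>S\<close> that normalizes \<open>A\<close>. Then \<open>A\<close> and \<open>A\<^sup>b\<close> normalize each other,
  \<open>I = A \<inter> A\<^sup>b\<close> is central in \<open>A A\<^sup>b\<close>, and \<open>U = {z a\<^sup>-\<^sup>1 a\<^sup>b | z \<in> I, a \<in> A}\<close> replaces \<open>A\<close>. The map
  \<open>a \<mapsto> I a\<^sup>-\<^sup>1 a\<^sup>b\<close> is a homomorphism onto \<open>U / I\<close> with kernel \<open>I\<close>, so \<open>|U| = |A|\<close>; the same applied to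
  \<open>\<Omega>\<^sub>i(A)\<close> gives \<open>\<omega>\<^sub>i(U) \<ge> \<omega>\<^sub>i(A)\<close>, and the exponent does not grow because \<open>A A\<^sup>b\<close> has class at most
  two and \<open>p\<close> is odd. To see that \<open>U\<close> is abelian, note that \<open>q = [a\<^sup>-\<^sup>1 a\<^sup>b, c\<^sup>-\<^sup>1 c\<^sup>b]\<close> lies in \<open>[B, B]\<close> and
  is fixed by \<open>b\<close>, whereas \<open>q = s t\<^sup>-\<^sup>1\<close> for central elements \<open>s\<close>, \<open>t\<close> that \<open>b\<close> swaps; hence \<open>q\<^sup>2 = 1\<close> and
  \<open>q = 1\<close>. Finally \<open>U \<inter> B\<close> is larger than \<open>A \<inter> B\<close>, and \<open>B\<close> is not contained in \<open>U\<close> since \<open>U\<close>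
  normalizes \<open>A\<close>: a contradiction.
\<close>

section \<open>Conjugation and commuting elements\<close>

definition conj_by :: "('a, 'b) monoid_scheme \<Rightarrow> 'a \<Rightarrow> 'a \<Rightarrow> 'a" where
  "conj_by G b a = b \<otimes>\<^bsub>G\<^esub> a \<otimes>\<^bsub>G\<^esub> inv\<^bsub>G\<^esub> b"

lemma card_eq_fibres:
  assumes "finite T" "\<And>y. y \<in> f ` T \<Longrightarrow> card {x \<in> T. f x = y} = k"
  shows "card T = k * card (f ` T)"
proof -
  have "card T = (\<Sum>y\<in>f ` T. card {x \<in> T. f x = y})"
    using sum.image_gen[OF assms(1), of "\<lambda>_. 1::nat" f] by simp
  then show ?thesis using assms(2) by simp
qed

context group begin

lemma mult_inv_cancel [simp]:
  assumes "x \<in> carrier G" "y \<in> carrier G"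
  shows "x \<otimes> (inv x \<otimes> y) = y" "inv x \<otimes> (x \<otimes> y) = y"
  using assms by (simp_all add: m_assoc [symmetric])

lemma conj_by_closed [simp, intro]:
  "b \<in> carrier G \<Longrightarrow> a \<in> carrier G \<Longrightarrow> conj_by G b a \<in> carrier G"
  by (simp add: conj_by_def)

lemma conj_by_mult:
  "b \<in> carrier G \<Longrightarrow> x \<in> carrier G \<Longrightarrow> y \<in> carrier G \<Longrightarrow>
     conj_by G b (x \<otimes> y) = conj_by G b x \<otimes> conj_by G b y"
  by (simp add: conj_by_def m_assoc)

lemma conj_by_one [simp]: "b \<in> carrier G \<Longrightarrow> conj_by G b \<one> = \<one>"
  by (simp add: conj_by_def)

lemma conj_by_inv:
  "b \<in> carrier G \<Longrightarrow> x \<in> carrier G \<Longrightarrow> conj_by G b (inv x) = inv (conj_by G b x)"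
  by (simp add: conj_by_def inv_mult_group m_assoc)

lemma conj_by_pow:
  "b \<in> carrier G \<Longrightarrow> x \<in> carrier G \<Longrightarrow> conj_by G b (x [^] (k::nat)) = conj_by G b x [^] k"
  by (induction k) (simp_all add: conj_by_mult)

lemma conj_by_conj_by:
  "b \<in> carrier G \<Longrightarrow> c \<in> carrier G \<Longrightarrow> x \<in> carrier G \<Longrightarrow>
     conj_by G b (conj_by G c x) = conj_by G (b \<otimes> c) x"
  by (simp add: conj_by_def inv_mult_group m_assoc)

lemma conj_by_id [simp]: "x \<in> carrier G \<Longrightarrow> conj_by G \<one> x = x"
  by (simp add: conj_by_def)

lemma conj_by_inj: "b \<in> carrier G \<Longrightarrow> inj_on (conj_by G b) (carrier G)"
  by (rule inj_onI) (simp add: conj_by_def)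

lemma subgroup_conj_image:
  assumes "b \<in> carrier G" "subgroup A G"
  shows "subgroup (conj_by G b ` A) G"
proof -
  interpret A: subgroup A G by fact
  show ?thesis
  proof (rule subgroupI)
    show "inv x \<in> conj_by G b ` A" if "x \<in> conj_by G b ` A" for x
      using that assms by (auto simp: conj_by_inv [symmetric] intro!: imageI)
    show "x \<otimes> y \<in> conj_by G b ` A" if "x \<in> conj_by G b ` A" "y \<in> conj_by G b ` A" for x y
      using that assms by (auto simp: conj_by_mult [symmetric] intro!: imageI)
    show "conj_by G b ` A \<noteq> {}" using A.one_closed by blast
  qed (use assms in auto)
qed

lemma mult_commute_left:
  assumes "x \<otimes> y = y \<otimes> x" "x \<in> carrier G" "y \<in> carrier G" "g \<in> carrier G"
  shows "x \<otimes> (y \<otimes> g) = y \<otimes> (x \<otimes> g)"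
  using assms by (simp flip: m_assoc)

text \<open>The class-two power formula: sorting the factors moves each \<open>x\<close> past the
  \<open>y\<close>s before it, at the price of one \<open>r\<close> per swap. The exponent of
  \<open>r\<close> is m(m-1)/2, kept as a sum until its divisibility matters.\<close>

lemma pow_mult_twisted:
  assumes c: "x \<in> carrier G" "y \<in> carrier G" "r \<in> carrier G"
    and yx: "y \<otimes> x = r \<otimes> (x \<otimes> y)" and rx: "x \<otimes> r = r \<otimes> x" and ry: "y \<otimes> r = r \<otimes> y"
  shows "(x \<otimes> y) [^] (m::nat) = r [^] (\<Sum>{..<m}) \<otimes> (x [^] m \<otimes> y [^] m)"
proof -
  have yr: "y [^] m \<otimes> r = r \<otimes> y [^] m" and xr: "r [^] m \<otimes> x = x \<otimes> r [^] m" for m :: nat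
    using group_commutes_pow[OF ry] group_commutes_pow[OF rx[symmetric]] c by auto
  have xxr: "x [^] k \<otimes> r [^] m = r [^] m \<otimes> x [^] k" for m k :: nat
    using group_commutes_pow[OF xr[symmetric]] c by simp
  have ymx: "y [^] m \<otimes> x = r [^] m \<otimes> (x \<otimes> y [^] m)" for m :: nat
  proof (induction m)
    case (Suc m)
    have "y [^] Suc m \<otimes> x = y [^] m \<otimes> (r \<otimes> (x \<otimes> y))"
      using c by (simp add: m_assoc yx)
    also have "\<dots> = r \<otimes> (y [^] m \<otimes> x \<otimes> y)"
      using c mult_commute_left[OF yr] by (simp add: m_assoc)
    also have "\<dots> = (r \<otimes> r [^] m) \<otimes> (x \<otimes> y [^] Suc m)"
      using c by (simp add: m_assoc Suc)
    finally show ?case using c nat_pow_Suc2 by simp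
  qed (use c in simp)
  show ?thesis
  proof (induction m)
    case (Suc m)
    have "(x \<otimes> y) [^] Suc m = r [^] (\<Sum>{..<m}) \<otimes> (x [^] m \<otimes> (y [^] m \<otimes> x \<otimes> y))"
      using c by (simp add: Suc m_assoc)
    also have "\<dots> = r [^] (\<Sum>{..<m}) \<otimes> (x [^] m \<otimes> (r [^] m \<otimes> (x \<otimes> y [^] Suc m)))"
      using c by (simp add: ymx m_assoc)
    also have "\<dots> = r [^] (\<Sum>{..<m}) \<otimes> (r [^] m \<otimes> (x [^] m \<otimes> (x \<otimes> y [^] Suc m)))"
      using c by (simp only: mult_commute_left[OF xxr] nat_pow_closed m_closed)
    also have "\<dots> = r [^] (\<Sum>{..<Suc m}) \<otimes> (x [^] Suc m \<otimes> y [^] Suc m)"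
      using c by (simp add: m_assoc flip: nat_pow_mult)
    finally show ?case .
  qed (use c in simp)
qed

end

section \<open>The replacement subgroup \<open>U\<close>: closure, order, exponent\<close>

text \<open>
  The inverse image of \<open>A \<inter> A\<^sup>b\<close> under \<open>a \<mapsto> a\<^sup>-\<^sup>1 a\<^sup>b\<close> has to be \<open>A \<inter> A\<^sup>b\<close> itself for \<open>|U| = |A|\<close>
  to hold; this is what \<open>inv_I\<close> is for.
\<close>

locale conj_pair = group G for G (structure) +
  fixes A b
  assumes A: "subgroup A G"
    and fin: "finite A"
    and comm: "x \<in> A \<Longrightarrow> y \<in> A \<Longrightarrow> x \<otimes> y = y \<otimes> x"
    and b: "b \<in> carrier G"
    and norm1: "x \<in> A \<Longrightarrow> y \<in> A \<Longrightarrow> conj_by G (conj_by G b x) y \<in> A"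
    and norm2: "x \<in> A \<Longrightarrow> y \<in> conj_by G b ` A \<Longrightarrow> conj_by G x y \<in> conj_by G b ` A"
    and inv_I: "x \<in> A \<Longrightarrow> x \<in> conj_by G b ` A \<Longrightarrow> conj_by G b x \<in> A"
begin

abbreviation cb where "cb \<equiv> conj_by G b"

sublocale A: subgroup A G by (rule A)
sublocale A': subgroup "cb ` A" G by (rule subgroup_conj_image[OF b A])

definition I where "I = A \<inter> cb ` A"
definition quot where "quot a = inv a \<otimes> cb a"
definition U where "U = {z \<otimes> quot a | z a. z \<in> I \<and> a \<in> A}"

sublocale I: subgroup I G
  unfolding I_def using A A'.subgroup_axioms by (rule subgroups_Inter_pair)

lemma I_A: "z \<in> I \<Longrightarrow> z \<in> A"
  by (simp add: I_def)

lemma cb_closed [simp, intro]: "a \<in> A \<Longrightarrow> cb a \<in> carrier G"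
  using b by auto

lemma quot_closed [simp, intro]: "a \<in> A \<Longrightarrow> quot a \<in> carrier G"
  by (simp add: quot_def)

lemma cb_comm: "x \<in> A \<Longrightarrow> y \<in> A \<Longrightarrow> cb x \<otimes> cb y = cb y \<otimes> cb x"
  using comm[of x y] b by (simp flip: conj_by_mult)

lemma central:
  assumes "z \<in> I" "a \<in> A"
  shows "a \<otimes> z = z \<otimes> a" "cb a \<otimes> z = z \<otimes> cb a"
  using assms comm[of a z] cb_comm by (auto simp: I_def)

lemma central_left:
  assumes "z \<in> I" "a \<in> A" "x \<in> carrier G"
  shows "a \<otimes> (z \<otimes> x) = z \<otimes> (a \<otimes> x)" "cb a \<otimes> (z \<otimes> x) = z \<otimes> (cb a \<otimes> x)"
    "inv a \<otimes> (z \<otimes> x) = z \<otimes> (inv a \<otimes> x)"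
  using central[OF assms(1,2)] central[OF assms(1), of "inv a"] assms by (simp_all flip: m_assoc)

lemma comm_left: "x \<in> A \<Longrightarrow> y \<in> A \<Longrightarrow> g \<in> carrier G \<Longrightarrow> x \<otimes> (y \<otimes> g) = y \<otimes> (x \<otimes> g)"
  using comm[of x y] by (simp flip: m_assoc)

lemma commutator:
  assumes "a \<in> A" "c \<in> A"
  obtains s where "s \<in> I" "cb a \<otimes> c = s \<otimes> (c \<otimes> cb a)"
    "\<And>x. x \<in> carrier G \<Longrightarrow> cb a \<otimes> (c \<otimes> x) = s \<otimes> (c \<otimes> (cb a \<otimes> x))"
proof
  let ?s = "cb a \<otimes> c \<otimes> inv (cb a) \<otimes> inv c"
  have "?s \<in> A"
    using norm1[OF assms] assms by (auto simp: conj_by_def[of G "cb a"])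
  moreover have "?s = cb a \<otimes> conj_by G c (inv (cb a))"
    using assms by (simp add: conj_by_def[of G c] m_assoc)
  ultimately show I: "?s \<in> I"
    using norm2[OF assms(2), of "inv (cb a)"] assms unfolding I_def by auto
  show *: "cb a \<otimes> c = ?s \<otimes> (c \<otimes> cb a)" using assms by (simp add: m_assoc)
  show "cb a \<otimes> (c \<otimes> x) = ?s \<otimes> (c \<otimes> (cb a \<otimes> x))" if "x \<in> carrier G" for x
    using * that assms I by (simp add: m_assoc)
qed

lemma U_I: "z \<in> I \<Longrightarrow> a \<in> A \<Longrightarrow> z \<otimes> quot a \<in> U"
  unfolding U_def by blast

lemma I_U: "z \<in> I \<Longrightarrow> z \<in> U"
  using U_I[of z \<one>] b by (simp add: quot_def)

lemma quot_U: "a \<in> A \<Longrightarrow> quot a \<in> U"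
  using U_I[of \<one> a] by simp

text \<open>Sorting the product needs one swap, of \<open>cb a\<close> with \<open>inv c\<close>;
  its commutator \<open>s\<close> is central and moves to the front. So \<open>quot\<close> is a
  homomorphism modulo \<open>I\<close>.\<close>

lemma quot_mult:
  assumes "a \<in> A" "c \<in> A"
  shows "\<exists>s\<in>I. quot a \<otimes> quot c = s \<otimes> quot (a \<otimes> c)"
proof -
  obtain s where s: "s \<in> I"
    "\<And>x. x \<in> carrier G \<Longrightarrow> cb a \<otimes> (inv c \<otimes> x) = s \<otimes> (inv c \<otimes> (cb a \<otimes> x))"
    using commutator[of a "inv c"] assms by auto
  have c: "a \<in> carrier G" "c \<in> carrier G" "s \<in> carrier G" using assms s(1) by simp_all
  have "quot a \<otimes> quot c = inv a \<otimes> (cb a \<otimes> (inv c \<otimes> cb c))"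
    using c b by (simp add: quot_def m_assoc)
  also have "\<dots> = inv a \<otimes> (s \<otimes> (inv c \<otimes> (cb a \<otimes> cb c)))"
    using c b by (simp add: s(2))
  also have "\<dots> = s \<otimes> (inv a \<otimes> (inv c \<otimes> (cb a \<otimes> cb c)))"
    using central_left(3)[OF s(1) assms(1)] c b by simp
  also have "inv a \<otimes> (inv c \<otimes> (cb a \<otimes> cb c)) = quot (a \<otimes> c)"
    using comm_left[of "inv a" "inv c"] assms c b
    by (simp add: quot_def conj_by_mult inv_mult_group m_assoc)
  finally show ?thesis using s by blast
qed

lemma U_subgroup: "subgroup U G"
proof (rule group.subgroupI)
  have mult: "x \<otimes> y \<in> U" if "x \<in> U" "y \<in> U" for x y
  proof -
    from that obtain z a w c where za: "z \<in> I" "a \<in> A" "w \<in> I" "c \<in> A"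
      "x = z \<otimes> quot a" "y = w \<otimes> quot c" unfolding U_def by blast
    obtain s where s: "s \<in> I" "quot a \<otimes> quot c = s \<otimes> quot (a \<otimes> c)"
      using quot_mult za by blast
    have "x \<otimes> y = z \<otimes> w \<otimes> (quot a \<otimes> quot c)"
      using za by (simp add: quot_def m_assoc central_left)
    also have "\<dots> = (z \<otimes> w \<otimes> s) \<otimes> quot (a \<otimes> c)"
      using za s by (simp add: m_assoc)
    finally show ?thesis unfolding U_def using za s(1) by blast
  qed
  show "x \<otimes> y \<in> U" if "x \<in> U" "y \<in> U" for x y by (rule mult[OF that])
  show "inv x \<in> U" if "x \<in> U" for x
  proof -
    from that obtain z a where za: "z \<in> I" "a \<in> A" "x = z \<otimes> quot a" unfolding U_def by blast
    obtain s where s: "s \<in> I" "quot a \<otimes> quot (inv a) = s \<otimes> quot (a \<otimes> inv a)"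
      using quot_mult za by blast
    have [simp]: "quot \<one> = \<one>" using b by (simp add: quot_def)
    \<comment> \<open>As \<open>quot \<one> = \<one>\<close>, the product of \<open>quot a\<close>
      and \<open>quot (inv a)\<close> is just \<open>s\<close>; this dictates the correction factor
      in the inverse.\<close>
    have "x \<otimes> (quot (inv a) \<otimes> inv (z \<otimes> s)) = \<one>"
    proof -
      have "x \<otimes> (quot (inv a) \<otimes> inv (z \<otimes> s)) = z \<otimes> (quot a \<otimes> quot (inv a)) \<otimes> inv (z \<otimes> s)"
        using za s(1) by (simp add: m_assoc)
      also have "\<dots> = \<one>" using za s by simp
      finally show ?thesis .
    qed
    then have "inv (quot (inv a) \<otimes> inv (z \<otimes> s)) = x"
      using za s(1) by (intro inv_equality) simp_all
    then have "inv x = quot (inv a) \<otimes> inv (z \<otimes> s)"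
      using za(2) s(1) za(1) by (metis A.m_inv_closed I.m_closed I.m_inv_closed I.mem_carrier inv_inv m_closed quot_closed)
    also have "\<dots> \<in> U" using mult[OF quot_U I_U] za s by blast
    finally show ?thesis .
  qed
  show "U \<noteq> {}" using I_U I.one_closed by blast
  show "U \<subseteq> carrier G" by (auto simp: U_def)
qed (rule is_group)

sublocale U: subgroup U G by (rule U_subgroup)

text \<open>\<open>A\<close> normalizes itself and, by \<open>norm1\<close>, so does every
  \<open>cb c\<close>. The lemma serves to show that an element moving \<open>A\<close> lies outside
  \<open>U\<close>.\<close>

lemma U_normalizes:
  assumes "x \<in> U" "a \<in> A"
  shows "conj_by G x a \<in> A"
proof -
  from assms obtain z c where zc: "z \<in> I" "c \<in> A" "x = z \<otimes> (inv c \<otimes> cb c)"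
    unfolding U_def quot_def by blast
  have AA: "conj_by G y d \<in> A" if "y \<in> A" "d \<in> A" for y d
    using that by (simp add: conj_by_def)
  have "conj_by G x a = conj_by G z (conj_by G (inv c) (conj_by G (cb c) a))"
    using zc assms by (simp add: conj_by_conj_by)
  then show ?thesis using AA norm1 zc assms I_A by simp
qed

lemma quot_mem_I:
  assumes "k \<in> A" "quot k \<in> I"
  shows "k \<in> I"
proof -
  have "k = cb k \<otimes> inv (quot k)"
    using assms(1) by (simp add: quot_def inv_mult_group)
  also have "\<dots> \<in> cb ` A" using assms unfolding I_def by blast
  finally show ?thesis using assms by (simp add: I_def)
qed

text \<open>\<open>U\<close> is the image of \<open>I \<times> A\<close> under \<open>?f\<close>,
  and every fibre has \<open>card I\<close> elements; cancelling \<open>card I\<close> leaves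
  \<open>card A\<close>.\<close>

lemma card_U: "card U = card A"
proof -
  let ?f = "\<lambda>(z, a). z \<otimes> quot a"
  have fI: "finite I" using fin by (simp add: I_def)
  have U: "U = ?f ` (I \<times> A)" unfolding U_def by auto
  have cI: "cb k \<in> I" if "k \<in> I" for k
    using that inv_I[of k] by (auto simp: I_def)
  \<comment> \<open>With one argument in \<open>I\<close> the error factor of
    \<open>quot_mult\<close> disappears, because \<open>cb k\<close> is again in \<open>I\<close>
    and hence central.\<close>
  have quot_I: "quot (k \<otimes> a) = quot k \<otimes> quot a" if "k \<in> I" "a \<in> A" for k a
  proof -
    have c: "k \<in> A" "k \<in> carrier G" "a \<in> carrier G" using that I_A by auto
    have "quot (k \<otimes> a) = inv a \<otimes> (inv k \<otimes> (cb k \<otimes> cb a))"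
      using c b by (simp add: quot_def m_assoc inv_mult_group conj_by_mult)
    also have "\<dots> = inv k \<otimes> (inv a \<otimes> (cb k \<otimes> cb a))"
      using c b that by (intro comm_left) simp_all
    also have "inv a \<otimes> (cb k \<otimes> cb a) = cb k \<otimes> (inv a \<otimes> cb a)"
      using c b that cI by (intro central_left) simp_all
    finally show ?thesis using c b by (simp add: quot_def m_assoc)
  qed
  have qI: "quot k \<in> I" if "k \<in> I" for k using that cI by (simp add: quot_def)
  have "card {x \<in> I \<times> A. ?f x = y} = card I" if "y \<in> ?f ` (I \<times> A)" for y
  proof -
    from that obtain z0 a0 where y: "y = z0 \<otimes> quot a0" "z0 \<in> I" "a0 \<in> A" by auto
    \<comment> \<open>The fibre through \<open>(z0, a0)\<close>: shift \<open>a0\<close> by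
      \<open>k\<close> in \<open>I\<close> and compensate in the first component.\<close>
    let ?g = "\<lambda>k. (z0 \<otimes> inv (quot k), k \<otimes> a0)"
    have inj: "inj_on ?g I" using y by (auto intro!: inj_onI)
    have img: "?g ` I = {x \<in> I \<times> A. ?f x = y}"
    proof (intro equalityI subsetI)
      fix x assume "x \<in> ?g ` I"
      then obtain k where k: "k \<in> I" "x = ?g k" by blast
      have "z0 \<otimes> inv (quot k) \<otimes> quot (k \<otimes> a0) = y"
        using y k(1) qI[of k] I_A[of k] by (simp add: quot_I m_assoc)
      then show "x \<in> {x \<in> I \<times> A. ?f x = y}"
        using k y qI[of k] I_A[of k] by simp
    next
      fix x assume "x \<in> {x \<in> I \<times> A. ?f x = y}"
      then obtain z a where x: "x = (z, a)" "z \<in> I" "a \<in> A" "z \<otimes> quot a = z0 \<otimes> quot a0"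
        using y by auto
      \<comment> \<open>For two points of one fibre, \<open>quot k\<close> lies in \<open>I\<close>
        by \<open>quot_mult\<close>, whence \<open>k\<close> itself does by
        \<open>quot_mem_I\<close>.\<close>
      define k where "k = a \<otimes> inv a0"
      have k: "k \<in> A" "a = k \<otimes> a0" using x y by (auto simp: k_def m_assoc)
      obtain s where s: "s \<in> I" "quot k \<otimes> quot a0 = s \<otimes> quot a"
        using quot_mult[of k a0] k y by auto
      have "quot k = s \<otimes> quot a \<otimes> inv (quot a0)"
        using s k x y by (simp add: inv_solve_right)
      moreover have "quot a = inv z \<otimes> z0 \<otimes> quot a0"
        using x y by (simp add: inv_solve_left m_assoc)
      ultimately have "quot k = s \<otimes> (inv z \<otimes> z0)" using x y s by (simp add: m_assoc)
      then have "k \<in> I" using quot_mem_I k x y s by simp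
      moreover have "z = z0 \<otimes> inv (quot k)"
      proof -
        have "z \<otimes> quot k \<otimes> quot a0 = z0 \<otimes> quot a0"
          using x(4) \<open>k \<in> I\<close> k x y by (simp add: quot_I m_assoc)
        then have "z \<otimes> quot k = z0" using x k y by simp
        then show ?thesis using x y k by (auto simp: m_assoc)
      qed
      ultimately show "x \<in> ?g ` I" using x k by blast
    qed
    from card_image[OF inj] show ?thesis unfolding img .
  qed
  from card_eq_fibres[OF _ this] fin fI have "card (I \<times> A) = card I * card U"
    unfolding U by blast
  moreover have "card I > 0" using fI I.one_closed by (metis card_gt_0_iff empty_iff)
  ultimately show ?thesis by (simp add: card_cartesian_product)
qed

text \<open>By the class-two power formula the powers of \<open>inv a\<close> and
  \<open>cb a\<close> vanish, and so does that of the commutator \<open>s\<close> in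
  \<open>I\<close>, whose exponent k(k-1)/2 is a multiple of \<open>k\<close> for odd
  \<open>k\<close>.\<close>

lemma U_pow:
  assumes "odd k" "\<And>a. a \<in> A \<Longrightarrow> a [^] k = \<one>" "x \<in> U"
  shows "x [^] (k::nat) = \<one>"
proof -
  from assms(3) obtain z a where za: "z \<in> I" "a \<in> A" "x = z \<otimes> quot a" unfolding U_def by blast
  obtain s where s: "s \<in> I" "cb a \<otimes> inv a = s \<otimes> (inv a \<otimes> cb a)"
    using commutator[of a "inv a"] za by auto
  have quot_pow: "quot a [^] k = s [^] (\<Sum>{..<k}) \<otimes> (inv a [^] k \<otimes> cb a [^] k)"
    unfolding quot_def using za central[OF s(1), of "inv a"] central[OF s(1), of a] s
    by (intro pow_mult_twisted) simp_all
  have "k dvd \<Sum>{..<k}"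
  proof -
    have "2 * \<Sum>{..<k} = k * (k - 1)"
      using gauss_sum_nat[of "k - 1"] assms(1) by (cases k) (auto simp: lessThan_Suc_atMost atLeast0AtMost)
    moreover have "coprime k 2" using assms(1) by simp
    ultimately show ?thesis by (metis coprime_dvd_mult_right_iff dvd_triv_left)
  qed
  then have "s [^] (\<Sum>{..<k}) = \<one>"
    using assms(2)[of s] s(1) I_A by (auto simp: nat_pow_pow[symmetric])
  moreover have "cb a [^] k = \<one>"
    using assms(2)[of a] za b by (simp flip: conj_by_pow)
  ultimately have "quot a [^] k = \<one>"
    using quot_pow assms(2)[of "inv a"] za by simp
  moreover have "z \<otimes> quot a = quot a \<otimes> z"
    using za by (simp add: quot_def m_assoc central central_left)
  then have "x [^] k = z [^] k \<otimes> quot a [^] k"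
    unfolding za(3) using za by (intro pow_mult_distrib) simp_all
  ultimately show ?thesis using assms(2)[of z] za I_A by simp
qed

end

section \<open>Commutativity of \<open>U\<close>\<close>

context group begin

lemma commute_inv:
  assumes "x \<otimes> y = y \<otimes> x" "x \<in> carrier G" "y \<in> carrier G"
  shows "x \<otimes> inv y = inv y \<otimes> x"
  using assms by (metis inv_closed inv_solve_left inv_solve_right m_assoc m_closed)

text \<open>Intended reading: \<alpha> and \<gamma> are the conjugates of \<open>a\<close> and
  \<open>c\<close>, and \<sigma> is that of the commutator \<open>s\<close>. In \<open>h\<close> the
  outer \<alpha> and \<open>w\<close> cancel, which leaves \<sigma> as the commutator of
  \<open>inv a\<close> and \<open>inv \<gamma>\<close>; \<open>t\<close> gives the same
  commutator.\<close>

lemma conj_twist: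
  assumes c: "a \<in> carrier G" "\<alpha> \<in> carrier G" "\<gamma> \<in> carrier G" "\<sigma> \<in> carrier G" "t \<in> carrier G" "w \<in> carrier G"
    and h: "(\<alpha> \<otimes> inv a \<otimes> \<alpha> \<otimes> w) \<otimes> inv \<gamma> = \<sigma> \<otimes> (inv \<gamma> \<otimes> (\<alpha> \<otimes> inv a \<otimes> \<alpha> \<otimes> w))"
    and w: "w \<otimes> inv \<gamma> = inv \<gamma> \<otimes> w"
    and \<gamma>: "\<alpha> \<otimes> \<gamma> = \<gamma> \<otimes> \<alpha>" and \<sigma>: "\<sigma> \<otimes> \<alpha> = \<alpha> \<otimes> \<sigma>"
    and t: "\<gamma> \<otimes> inv a = t \<otimes> (inv a \<otimes> \<gamma>)" "\<gamma> \<otimes> t = t \<otimes> \<gamma>"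
  shows "\<sigma> = t"
proof -
  have \<gamma>': "\<alpha> \<otimes> inv \<gamma> = inv \<gamma> \<otimes> \<alpha>" by (rule commute_inv[OF \<gamma> c(2,3)])
  have "\<alpha> \<otimes> (inv a \<otimes> inv \<gamma> \<otimes> (\<alpha> \<otimes> w)) = \<alpha> \<otimes> inv a \<otimes> (inv \<gamma> \<otimes> \<alpha>) \<otimes> w"
    using c by (simp add: m_assoc)
  also have "\<dots> = \<alpha> \<otimes> inv a \<otimes> \<alpha> \<otimes> (inv \<gamma> \<otimes> w)"
    unfolding \<gamma>'[symmetric] using c by (simp add: m_assoc)
  also have "\<dots> = (\<alpha> \<otimes> inv a \<otimes> \<alpha> \<otimes> w) \<otimes> inv \<gamma>"
    unfolding w[symmetric] using c by (simp add: m_assoc)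
  also have "\<dots> = \<sigma> \<otimes> ((inv \<gamma> \<otimes> \<alpha>) \<otimes> (inv a \<otimes> (\<alpha> \<otimes> w)))"
    unfolding h using c by (simp add: m_assoc)
  also have "\<dots> = (\<sigma> \<otimes> \<alpha>) \<otimes> (inv \<gamma> \<otimes> (inv a \<otimes> (\<alpha> \<otimes> w)))"
    unfolding \<gamma>'[symmetric] using c by (simp add: m_assoc)
  also have "\<dots> = \<alpha> \<otimes> (\<sigma> \<otimes> (inv \<gamma> \<otimes> inv a) \<otimes> (\<alpha> \<otimes> w))"
    unfolding \<sigma> using c by (simp add: m_assoc)
  finally have 1: "inv a \<otimes> inv \<gamma> = \<sigma> \<otimes> (inv \<gamma> \<otimes> inv a)"
    using c by simp
  have "inv a \<otimes> inv \<gamma> = inv \<gamma> \<otimes> (\<gamma> \<otimes> inv a) \<otimes> inv \<gamma>"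
    using c by (simp add: m_assoc)
  also have "\<dots> = (inv \<gamma> \<otimes> t) \<otimes> inv a"
    unfolding t(1) using c by (simp add: m_assoc)
  also have "inv \<gamma> \<otimes> t = t \<otimes> inv \<gamma>"
    by (rule commute_inv[OF t(2)[symmetric] c(5,3), symmetric])
  finally have "inv a \<otimes> inv \<gamma> = t \<otimes> (inv \<gamma> \<otimes> inv a)"
    using c by (simp add: m_assoc)
  with 1 show ?thesis using c by simp
qed

end

context conj_pair begin

text \<open>
  Together with its mirror image this says that conjugation by \<open>b\<close> swaps \<open>s = [a\<^sup>b, c\<^sup>-\<^sup>1]\<close> and
  \<open>t = [c\<^sup>b, a\<^sup>-\<^sup>1]\<close>.
\<close>

lemma conj_commutator:
  assumes a: "a \<in> A" and c: "c \<in> A" and s: "s \<in> I" and t: "t \<in> I" and w: "w \<in> I"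
    and as: "cb a \<otimes> inv c = s \<otimes> (inv c \<otimes> cb a)"
    and ct: "cb c \<otimes> inv a = t \<otimes> (inv a \<otimes> cb c)"
    and tw: "cb (cb a) = cb a \<otimes> inv a \<otimes> cb a \<otimes> w"
  shows "cb s = t"
proof -
  have cs: "cb s \<in> I" using s inv_I[of s] by (auto simp: I_def)
  have car: "a \<in> carrier G" "c \<in> carrier G" "s \<in> carrier G" "t \<in> carrier G" "w \<in> carrier G"
    using a c s t w by simp_all
  have "cb (cb a \<otimes> inv c) = cb (s \<otimes> (inv c \<otimes> cb a))" by (simp only: as)
  then have h: "cb (cb a) \<otimes> inv (cb c) = cb s \<otimes> (inv (cb c) \<otimes> cb (cb a))"
    using car b by (simp add: conj_by_mult conj_by_inv)
  show ?thesis
  proof (rule conj_twist)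
    show "w \<otimes> inv (cb c) = inv (cb c) \<otimes> w"
      using commute_inv[OF central(2)[OF w c, symmetric]] car b by simp
    show "cb s \<otimes> cb a = cb a \<otimes> cb s" using cb_comm[of s a] s a I_A by simp
  qed (use car b ct h cb_comm[OF a c] central(2)[OF t c] in \<open>simp_all add: tw\<close>)
qed

text \<open>\<open>W\<close> abstracts [B, B]: it lies in \<open>A\<close>, is fixed by
  \<open>b\<close>, and contains the commutators of elements \<open>quot a\<close>, which are in
  \<open>B\<close>. \<open>sq\<close> is the absence of involutions.\<close>

lemma quot_commute:
  assumes sq: "\<And>q. q \<in> carrier G \<Longrightarrow> q \<otimes> q = \<one> \<Longrightarrow> q = \<one>"
    and W: "\<And>w. w \<in> W \<Longrightarrow> w \<in> A \<and> cb w = w"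
    and tw: "\<And>a. a \<in> A \<Longrightarrow> \<exists>w\<in>W. cb (cb a) = cb a \<otimes> inv a \<otimes> cb a \<otimes> w"
    and q: "\<And>a c. a \<in> A \<Longrightarrow> c \<in> A \<Longrightarrow> quot a \<otimes> quot c \<otimes> inv (quot a) \<otimes> inv (quot c) \<in> W"
    and a: "a \<in> A" and c: "c \<in> A"
  shows "quot a \<otimes> quot c = quot c \<otimes> quot a"
proof -
  have WI: "w \<in> I" if "w \<in> W" for w using W[OF that] unfolding I_def by (metis IntI imageI)
  obtain s where s: "s \<in> I" "cb a \<otimes> inv c = s \<otimes> (inv c \<otimes> cb a)"
    using commutator[OF a A.m_inv_closed[OF c]] by blast
  obtain t where t: "t \<in> I" "cb c \<otimes> inv a = t \<otimes> (inv a \<otimes> cb c)"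
    using commutator[OF c A.m_inv_closed[OF a]] by blast
  obtain w where w: "w \<in> W" "cb (cb a) = cb a \<otimes> inv a \<otimes> cb a \<otimes> w"
    using tw[OF a] by blast
  obtain w' where w': "w' \<in> W" "cb (cb c) = cb c \<otimes> inv c \<otimes> cb c \<otimes> w'"
    using tw[OF c] by blast
  have st: "cb s = t" by (rule conj_commutator[OF a c s(1) t(1) WI[OF w(1)] s(2) t(2) w(2)])
  have ts: "cb t = s" by (rule conj_commutator[OF c a t(1) s(1) WI[OF w'(1)] t(2) s(2) w'(2)])
  have car: "a \<in> carrier G" "c \<in> carrier G" "s \<in> carrier G" "t \<in> carrier G" "cb a \<in> carrier G" "cb c \<in> carrier G"
    using a c s t by simp_all
  \<comment> \<open>The sorted product common to both orders: the two products of
    \<open>quot a\<close> and \<open>quot c\<close> are \<open>s \<otimes> m\<close> and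
    \<open>t \<otimes> m\<close>, so only \<open>s\<close> and \<open>t\<close> need
    comparing.\<close>
  define m where "m = inv a \<otimes> (inv c \<otimes> (cb a \<otimes> cb c))"
  have mcar: "m \<in> carrier G" using car by (simp add: m_def)
  have "quot a \<otimes> quot c = inv a \<otimes> (cb a \<otimes> inv c) \<otimes> cb c"
    using car by (simp add: quot_def m_assoc)
  also have "\<dots> = inv a \<otimes> (s \<otimes> (inv c \<otimes> (cb a \<otimes> cb c)))"
    unfolding s(2) using car by (simp add: m_assoc)
  also have "\<dots> = s \<otimes> m"
    unfolding m_def using central_left(3)[OF s(1) a] car by simp
  finally have uv: "quot a \<otimes> quot c = s \<otimes> m" .
  have "quot c \<otimes> quot a = inv c \<otimes> (cb c \<otimes> inv a) \<otimes> cb a"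
    using car by (simp add: quot_def m_assoc)
  also have "\<dots> = inv c \<otimes> (t \<otimes> (inv a \<otimes> (cb c \<otimes> cb a)))"
    unfolding t(2) using car by (simp add: m_assoc)
  also have "\<dots> = t \<otimes> (inv c \<otimes> (inv a \<otimes> (cb c \<otimes> cb a)))"
    using central_left(3)[OF t(1) c] car by simp
  also have "inv c \<otimes> (inv a \<otimes> (cb c \<otimes> cb a)) = m"
    unfolding m_def cb_comm[OF a c] using a c car by (intro comm_left) simp_all
  finally have vu: "quot c \<otimes> quot a = t \<otimes> m" .
  define r where "r = quot a \<otimes> quot c \<otimes> inv (quot a) \<otimes> inv (quot c)"
  have "r = (quot a \<otimes> quot c) \<otimes> inv (quot c \<otimes> quot a)"
    using a c by (simp add: r_def inv_mult_group m_assoc)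
  also have "\<dots> = s \<otimes> inv t"
    unfolding uv vu using car mcar by (simp add: inv_mult_group m_assoc)
  finally have r: "r = s \<otimes> inv t" .
  have "cb r = r" using W q[OF a c] unfolding r_def by blast
  moreover have "cb r = t \<otimes> inv s"
    unfolding r using car b by (simp add: conj_by_mult conj_by_inv st ts)
  ultimately have "r = t \<otimes> inv s" by simp
  \<comment> \<open>\<open>r\<close> is fixed by \<open>b\<close>, yet swapping \<open>s\<close> and
    \<open>t\<close> turns it into its inverse.\<close>
  then have "r \<otimes> r = (t \<otimes> inv s) \<otimes> (s \<otimes> inv t)" using r by metis
  then have rr: "r \<otimes> r = \<one>" using car by (simp add: m_assoc)
  have "r \<in> carrier G" unfolding r using car by simp
  from sq[OF this rr] have "r = \<one>" .
  then have "s = t" using r car by (metis inv_closed inv_equality inv_inv)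
  then show ?thesis using uv vu by simp
qed

lemma U_commute:
  assumes "\<And>a c. a \<in> A \<Longrightarrow> c \<in> A \<Longrightarrow> quot a \<otimes> quot c = quot c \<otimes> quot a"
    and "x \<in> U" "y \<in> U"
  shows "x \<otimes> y = y \<otimes> x"
proof -
  from assms obtain z a w c where za: "z \<in> I" "a \<in> A" "w \<in> I" "c \<in> A"
    "x = z \<otimes> quot a" "y = w \<otimes> quot c" unfolding U_def by blast
  have car: "z \<in> carrier G" "a \<in> carrier G" "w \<in> carrier G" "c \<in> carrier G"
    "quot a \<in> carrier G" "quot c \<in> carrier G" using za by simp_all
  have zc: "quot d \<otimes> v = v \<otimes> quot d" if "d \<in> A" "v \<in> I" for d v
  proof -
    have "v \<in> carrier G" "d \<in> carrier G" using that by simp_all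
    then have "quot d \<otimes> v = inv d \<otimes> (v \<otimes> cb d)"
      using central(2)[OF that(2,1)] b by (simp add: quot_def m_assoc)
    also have "\<dots> = v \<otimes> quot d"
      unfolding quot_def using central_left(3)[OF that(2,1)] that by simp
    finally show ?thesis .
  qed
  have "x \<otimes> y = z \<otimes> (w \<otimes> (quot a \<otimes> quot c))"
    unfolding za using car mult_commute_left[OF zc[OF za(2,3)]] by (simp add: m_assoc)
  also have "\<dots> = w \<otimes> (z \<otimes> (quot c \<otimes> quot a))"
    using assms(1)[OF za(2,4)] mult_commute_left[OF central(1)[OF za(1) I_A[OF za(3)], symmetric]] car by simp
  also have "\<dots> = y \<otimes> x"
    unfolding za using car mult_commute_left[OF zc[OF za(4,1)]] by (simp add: m_assoc)
  finally show ?thesis .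
qed

end

section \<open>Fixed points of p-groups\<close>

text \<open>Without a second fixed point, \<open>F - {x0}\<close> would split into orbits of p-power
  size greater than 1, so \<open>p\<close> would divide both \<open>card F\<close> and
  \<open>card F - 1\<close>.\<close>

lemma (in group_action) another_fixed_point:
  assumes p: "Factorial_Ring.prime p" "order G = p ^ n"
    and F: "F \<subseteq> E" "finite F" "p dvd card F" "\<And>g x. g \<in> carrier G \<Longrightarrow> x \<in> F \<Longrightarrow> \<phi> g x \<in> F"
    and x0: "x0 \<in> F" "\<And>g. g \<in> carrier G \<Longrightarrow> \<phi> g x0 = x0"
  shows "\<exists>x\<in>F. x \<noteq> x0 \<and> (\<forall>g\<in>carrier G. \<phi> g x = x)"
proof (rule ccontr)
  interpret group G using group_hom group_hom.axioms(1) by auto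
  assume nofix: "\<not> ?thesis"
  let ?C = "orbit G \<phi> ` (F - {x0})"
  have orb: "orbit G \<phi> x \<subseteq> F - {x0}" if "x \<in> F - {x0}" for x
  proof
    fix y assume y: "y \<in> orbit G \<phi> x"
    then have yF: "y \<in> F" using F(4) that by (auto simp: orbit_def)
    have "x \<in> orbit G \<phi> y" by (rule orbit_sym) (use y yF that F(1) in auto)
    then show "y \<in> F - {x0}" using yF x0 that by (auto simp: orbit_def)
  qed
  have U: "\<Union>?C = F - {x0}" using orb orbit_refl F(1) by blast
  have "p dvd card (\<Union>?C)"
  proof (rule dvd_partition)
    show "finite (\<Union>?C)" unfolding U using F(2) by simp
    show "\<forall>c\<in>?C. p dvd card c"
    proof
      fix c assume "c \<in> ?C"
      then obtain x where x: "x \<in> F" "x \<noteq> x0" "c = orbit G \<phi> x" by auto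
      have "card c dvd p ^ n"
        using orbit_stabilizer_theorem[of x] x F(1) p(2) by (metis dvd_triv_left subsetD)
      moreover have "card c \<noteq> 1"
      proof
        assume "card c = 1"
        then obtain y where "c = {y}" by (auto simp: card_1_singleton_iff)
        moreover have "x \<in> c" using orbit_refl x F(1) by auto
        ultimately have "\<forall>g\<in>carrier G. \<phi> g x = x" using x(3) by (auto simp: orbit_def)
        with nofix x show False by blast
      qed
      ultimately show "p dvd card c"
        using p(1) by (metis divides_primepow_nat dvd_power power_0 not_gr_zero)
    qed
    show "\<forall>c1\<in>?C. \<forall>c2\<in>?C. c1 \<noteq> c2 \<longrightarrow> c1 \<inter> c2 = {}"
      using disjoint_union F(1) unfolding orbits_def by blast
  qed
  then have "p dvd card F - 1" unfolding U using x0(1) F(2) by simp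
  moreover have "card F \<noteq> 0" using x0(1) F(2) by auto
  ultimately have "p dvd 1" using F(3) by (metis One_nat_def Suc_pred dvd_add_right_iff not_gr_zero plus_1_eq_Suc add.commute)
  then show False using p(1) by (simp add: not_prime_unit)
qed

section \<open>Elements central modulo a normal subgroup, and class two\<close>

context group begin

lemma derived_commutator:
  assumes "h \<in> B" "k \<in> B"
  shows "h \<otimes> k \<otimes> inv h \<otimes> inv k \<in> derived G B"
  unfolding derived_def using assms by (intro generate.incl) blast

lemma conj_rcoset:
  assumes M: "M \<lhd> G" and g: "g \<in> carrier G" and x: "x \<in> carrier G"
  shows "g <# (M #> x) #> inv g = M #> conj_by G g x"
proof -
  interpret M: normal M G by (rule M)
  have "g <# (M #> x) #> inv g = ((g <# M) #> x) #> inv g"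
    using g x M.subset by (simp add: rcos_assoc_lcos l_coset_def r_coset_def m_assoc image_iff)
  also have "g <# M = M #> g" using M.coset_eq g by simp
  also have "(M #> g #> x) #> inv g = M #> conj_by G g x"
    using g x M.subset by (simp add: coset_mult_assoc conj_by_def m_assoc)
  finally show ?thesis .
qed

text \<open>This is the fact that the nontrivial normal subgroup B/M of the p-group G/M meets the
  centre. It is proved by letting \<open>G\<close> act by conjugation on the cosets of
  \<open>M\<close> in \<open>B\<close>; their number is a p-power other than 1, and \<open>M\<close>
  is one fixed point.\<close>

lemma central_modulo:
  assumes p: "Factorial_Ring.prime p" "order G = p ^ n"
    and M: "M \<lhd> G" and B: "B \<lhd> G" and MB: "M \<subset> B"
  shows "\<exists>x\<in>B - M. \<forall>g\<in>carrier G. conj_by G g x \<in> M #> x"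
proof -
  interpret M: normal M G by (rule M)
  interpret B: normal B G by (rule B)
  have fin: "finite (carrier G)"
    using p order_gt_0_iff_finite by (metis prime_gt_0_nat zero_less_power)
  let ?P = "{H. H \<subseteq> carrier G}" and ?\<phi> = "\<lambda>g. \<lambda>H \<in> {H. H \<subseteq> carrier G}. g <# H #> inv g"
  interpret act: group_action G ?P ?\<phi> by (rule action_by_conjugation_on_power_set)
  define F where "F = (\<lambda>x. M #> x) ` B"
  have FP: "F \<subseteq> ?P" unfolding F_def using r_coset_subset_G[OF M.subset] B.subset by auto
  have finF: "finite F" unfolding F_def using fin B.subset finite_subset by blast
  have \<phi>: "?\<phi> g (M #> x) = M #> conj_by G g x" if "g \<in> carrier G" "x \<in> carrier G" for g x
    using conj_rcoset[OF M that] r_coset_subset_G[OF M.subset that(2)] by simp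
  have "M \<in> F" unfolding F_def using coset_mult_one[OF M.subset] by (metis B.one_closed imageI)
  have "card F * card M = card B"
  proof -
    interpret GB: group "G\<lparr>carrier := B\<rparr>" by (rule B.subgroup_is_group[OF is_group])
    have "subgroup M (G\<lparr>carrier := B\<rparr>)"
      using subgroup_incl[OF M.subgroup_axioms B.subgroup_axioms] MB by blast
    from GB.lagrange[OF this] have "card (rcosets\<^bsub>G\<lparr>carrier := B\<rparr>\<^esub> M) * card M = card B"
      by (simp add: order_def)
    moreover have "rcosets\<^bsub>G\<lparr>carrier := B\<rparr>\<^esub> M = F"
      by (auto simp: RCOSETS_def F_def r_coset_def)
    ultimately show ?thesis by simp
  qed
  moreover have "card B dvd p ^ n" using lagrange[OF B.subgroup_axioms] p(2) by (metis dvd_triv_right)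
  ultimately have "card F dvd p ^ n" by (metis dvd_mult_left)
  moreover have "card F \<noteq> 1"
  proof
    assume "card F = 1"
    then have "card M = card B" using \<open>card F * card M = card B\<close> by simp
    moreover have "finite B" using fin B.subset finite_subset by blast
    ultimately show False using MB psubset_card_mono by (metis less_irrefl)
  qed
  ultimately have "p dvd card F"
    using p(1) by (metis divides_primepow_nat dvd_power power_0 not_gr_zero)
  moreover have "?\<phi> g y \<in> F" if "g \<in> carrier G" "y \<in> F" for g y
  proof -
    from that(2) obtain x where x: "x \<in> B" "y = M #> x" unfolding F_def by blast
    have "conj_by G g x \<in> B" using B.inv_op_closed2 that(1) x(1) by (simp add: conj_by_def)
    moreover have "?\<phi> g y = M #> conj_by G g x" unfolding x(2) using \<phi>[OF that(1), of x] x(1) by simp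
    ultimately show ?thesis unfolding F_def by blast
  qed
  moreover have "?\<phi> g M = M" if "g \<in> carrier G" for g
    using \<phi>[OF that, of \<one>] that coset_mult_one[OF M.subset] by simp
  ultimately obtain y where y: "y \<in> F" "y \<noteq> M" "\<And>g. g \<in> carrier G \<Longrightarrow> ?\<phi> g y = y"
    using act.another_fixed_point[OF p FP finF _ _ \<open>M \<in> F\<close>] by blast
  from y(1) obtain x where x: "x \<in> B" "y = M #> x" unfolding F_def by blast
  have "x \<notin> M" using y(2) x coset_join2[OF _ M.subgroup_axioms, of x] by auto
  moreover have "conj_by G g x \<in> M #> x" if "g \<in> carrier G" for g
  proof -
    have "M #> conj_by G g x = M #> x" using \<phi>[OF that, of x] y(3)[OF that] x by simp
    then show ?thesis using rcos_self[OF _ M.subgroup_axioms, of "conj_by G g x"] that x(1) by simp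
  qed
  ultimately show ?thesis using x(1) by blast
qed

lemma subgroup_set_stabilizer:
  assumes "subgroup B G" "A \<subseteq> carrier G"
  shows "subgroup {m \<in> B. conj_by G m ` A = A} G"
proof -
  interpret B: subgroup B G by fact
  have *: "conj_by G x ` conj_by G y ` A = conj_by G (x \<otimes> y) ` A" if "x \<in> carrier G" "y \<in> carrier G" for x y
    unfolding image_image using that assms(2) by (intro image_cong) (auto simp: conj_by_conj_by)
  have 1: "conj_by G \<one> ` A = A"
    using assms(2) by (force simp: subset_iff image_iff)
  show ?thesis
  proof (rule subgroupI)
    fix x assume x: "x \<in> {m \<in> B. conj_by G m ` A = A}"
    then have "conj_by G (inv x) ` A = conj_by G (inv x) ` conj_by G x ` A" by simp
    also have "\<dots> = conj_by G (inv x \<otimes> x) ` A" using x by (intro *) simp_all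
    also have "\<dots> = A" using x 1 by simp
    finally show "inv x \<in> {m \<in> B. conj_by G m ` A = A}" using x by simp
  next
    fix x y assume x: "x \<in> {m \<in> B. conj_by G m ` A = A}" "y \<in> {m \<in> B. conj_by G m ` A = A}"
    then have "conj_by G (x \<otimes> y) ` A = A" using *[of x y] by simp
    then show "x \<otimes> y \<in> {m \<in> B. conj_by G m ` A = A}" using x by simp
  next
    show "{m \<in> B. conj_by G m ` A = A} \<noteq> {}" using 1 B.one_closed by blast
    show "{m \<in> B. conj_by G m ` A = A} \<subseteq> carrier G" by auto
  qed
qed

text \<open>The last property is the purpose: commutators of \<open>b\<close> with arbitrary
  elements normalize \<open>A\<close>, which will make \<open>A\<close> and its conjugate by
  \<open>b\<close> normalize each other.\<close>

lemma exists_almost_normalizing: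
  assumes p: "Factorial_Ring.prime p" "order G = p ^ n"
    and B: "B \<lhd> G" and A: "A \<subseteq> carrier G"
    and nB: "\<not> (\<forall>b\<in>B. conj_by G b ` A = A)"
  obtains M b where "M \<lhd> G" "\<And>m. m \<in> M \<Longrightarrow> conj_by G m ` A = A"
    "b \<in> B" "conj_by G b ` A \<noteq> A" "\<And>g. g \<in> carrier G \<Longrightarrow> conj_by G g b \<otimes> inv b \<in> M"
proof -
  interpret B: normal B G by (rule B)
  have fin: "finite (carrier G)"
    using p order_gt_0_iff_finite by (metis prime_gt_0_nat zero_less_power)
  \<comment> \<open>Take \<open>M\<close> maximal among the normal subgroups of \<open>G\<close> that normalize \<open>A\<close>, and \<open>b\<close> central modulo \<open>M\<close>.\<close>
  define N where "N = {m \<in> B. conj_by G m ` A = A}"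
  have N: "subgroup N G" unfolding N_def by (rule subgroup_set_stabilizer[OF B.subgroup_axioms A])
  interpret N: subgroup N G by (rule N)
  have "finite {M. M \<lhd> G \<and> M \<subseteq> N}"
    by (rule finite_subset[of _ "Pow N"]) (use finite_subset[OF N.subset fin] in blast)+
  moreover have "{\<one>} \<in> {M. M \<lhd> G \<and> M \<subseteq> N}" using one_is_normal by simp
  ultimately obtain M where M: "M \<lhd> G" "M \<subseteq> N"
    and max: "\<And>L. L \<lhd> G \<Longrightarrow> L \<subseteq> N \<Longrightarrow> M \<subseteq> L \<Longrightarrow> M = L"
    using finite_has_maximal2[of "{M. M \<lhd> G \<and> M \<subseteq> N}"] by (metis (no_types, lifting) mem_Collect_eq)
  interpret M: normal M G by (rule M)
  have "M \<subset> B" using M(2) nB unfolding N_def by blast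
  from central_modulo[OF p M(1) B this] obtain b
    where b: "b \<in> B" "b \<notin> M" "\<And>g. g \<in> carrier G \<Longrightarrow> conj_by G g b \<in> M #> b" by blast
  have bc: "b \<in> carrier G" using b(1) by simp
  have "conj_by G b ` A \<noteq> A"
  proof
    assume "conj_by G b ` A = A"
    then have bN: "b \<in> N" using b(1) by (simp add: N_def)
    \<comment> \<open>This set is invariant under conjugation because \<open>b\<close> is central
      modulo \<open>M\<close>. It generates a normal subgroup of \<open>G\<close> inside
      \<open>N\<close>, strictly larger than \<open>M\<close>.\<close>
    let ?H = "M \<union> (M #> b)"
    have HN: "?H \<subseteq> N" using M(2) bN by (auto simp: r_coset_def)
    have "generate G ?H \<lhd> G"
    proof (rule normal_generateI)
      show "?H \<subseteq> carrier G" using HN N.subset by blast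
      fix h g assume h: "h \<in> ?H" and g: "g \<in> carrier G"
      from h show "g \<otimes> h \<otimes> inv g \<in> ?H"
      proof
        assume "h \<in> M" then show ?thesis using M.inv_op_closed2 g by simp
      next
        assume "h \<in> M #> b"
        then obtain m where m: "m \<in> M" "h = m \<otimes> b" by (auto simp: r_coset_def)
        obtain m' where m': "m' \<in> M" "conj_by G g b = m' \<otimes> b"
          using b(3)[OF g] by (auto simp: r_coset_def)
        have "conj_by G g m \<in> M" using M.inv_op_closed2 g m(1) by (simp add: conj_by_def)
        moreover have "g \<otimes> h \<otimes> inv g = (conj_by G g m \<otimes> m') \<otimes> b"
        proof -
          have "g \<otimes> h \<otimes> inv g = conj_by G g (m \<otimes> b)" by (simp add: conj_by_def m)
          also have "\<dots> = conj_by G g m \<otimes> (m' \<otimes> b)" using g m(1) bc by (simp add: conj_by_mult m')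
          finally show ?thesis using g m(1) m'(1) bc by (simp add: m_assoc)
        qed
        ultimately show ?thesis using m'(1) by (auto simp: r_coset_def)
      qed
    qed
    moreover have "generate G ?H \<subseteq> N" by (rule generate_subgroup_incl[OF HN N])
    moreover have "?H \<subseteq> generate G ?H" by (auto intro: generate.incl)
    ultimately have "M #> b \<subseteq> M" using max by blast
    then show False using rcos_self[OF bc M.subgroup_axioms] b(2) by blast
  qed
  moreover have "conj_by G g b \<otimes> inv b \<in> M" if "g \<in> carrier G" for g
    using b(3)[OF that] bc by (auto simp: r_coset_def m_assoc)
  ultimately show ?thesis using that[OF M(1) _ b(1)] M(2) unfolding N_def by blast
qed

lemma class_two_commute:
  assumes B: "subgroup B G" and nil: "nilpotency_class_le G B 2"
    and w: "w \<in> derived G B" and x: "x \<in> B"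
  shows "w \<otimes> x = x \<otimes> w"
proof -
  interpret B: subgroup B G by (rule B)
  have wc: "w \<in> carrier G" using derived_in_carrier[OF B.subset] w by blast
  have "commutator_subgroup G B B = derived G B"
    unfolding commutator_subgroup_def derived_def by (rule arg_cong[of _ _ "generate G"]) blast
  \<comment> \<open>As the lower central series is numbered from 0, its entry 2 is [[B, B],
    B].\<close>
  then have "commutator_subgroup G (derived G B) B = {\<one>}"
    using nil by (simp add: nilpotency_class_le_def numeral_2_eq_2)
  moreover have "w \<otimes> x \<otimes> inv w \<otimes> inv x \<in> commutator_subgroup G (derived G B) B"
    unfolding commutator_subgroup_def using w x by (intro generate.incl) blast
  ultimately have "w \<otimes> x \<otimes> inv (x \<otimes> w) = \<one>"
    using wc x by (simp add: inv_mult_group m_assoc)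
  then have "inv (inv (x \<otimes> w)) = w \<otimes> x"
    using wc x by (intro inv_equality) simp_all
  then show ?thesis using wc x by simp
qed

text \<open>With \<open>u = inv a \<otimes> conj_by G b a\<close> in \<open>B\<close>, one
  conjugation multiplies \<open>a\<close> by \<open>u\<close>, and the next multiplies
  \<open>u\<close> by a commutator \<open>w\<close> of elements of \<open>B\<close>.\<close>

lemma conj_conj_class_two:
  assumes B: "B \<lhd> G" and nil: "nilpotency_class_le G B 2"
    and b: "b \<in> B" and a: "a \<in> carrier G"
  shows "\<exists>w\<in>derived G B.
    conj_by G b (conj_by G b a) = conj_by G b a \<otimes> inv a \<otimes> conj_by G b a \<otimes> w"
proof -
  interpret B: normal B G by (rule B)
  have bc: "b \<in> carrier G" using b by simp
  define u where "u = inv a \<otimes> conj_by G b a"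
  have "u = (inv a \<otimes> b \<otimes> a) \<otimes> inv b" using a bc by (simp add: u_def conj_by_def m_assoc)
  also have "\<dots> \<in> B" using B.inv_op_closed1[OF a b] b by simp
  finally have u: "u \<in> B" .
  define w where "w = inv u \<otimes> b \<otimes> inv (inv u) \<otimes> inv b"
  have w: "w \<in> derived G B" unfolding w_def using u b by (intro derived_commutator) simp_all
  have uc: "u \<in> carrier G" using u by simp
  have "conj_by G b a = a \<otimes> u" using a bc by (simp add: u_def)
  then have "conj_by G b (conj_by G b a) = conj_by G b a \<otimes> conj_by G b u"
    using a bc uc by (simp add: conj_by_mult)
  also have "conj_by G b u = u \<otimes> w" using uc bc by (simp add: w_def conj_by_def m_assoc)
  finally show ?thesis using w a bc by (intro bexI[of _ w]) (simp_all add: u_def m_assoc subsetD[OF derived_in_carrier[OF B.subset]])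
qed

end

section \<open>Torsion of \<open>U\<close>\<close>

context conj_pair begin

text \<open>Conjugation preserves k-torsion in both directions, so the whole construction can be
  repeated with the k-torsion of \<open>A\<close> in place of \<open>A\<close>.\<close>

lemma conj_pair_torsion: "conj_pair G {x \<in> A. x [^] (k::nat) = \<one>} b"
proof -
  let ?A = "{x \<in> A. x [^] k = \<one>}"
  have pow: "(conj_by G x y) [^] k = \<one>" if "x \<in> carrier G" "y \<in> carrier G" "y [^] k = \<one>" for x y
    using that by (simp flip: conj_by_pow)
  have pow': "y [^] k = \<one>" if "y \<in> carrier G" "cb y [^] k = \<one>" for y
  proof -
    have "cb (y [^] k) = cb \<one>" using that b by (simp add: conj_by_pow)
    then show ?thesis using conj_by_inj[OF b] that(1) by (auto dest: inj_onD)
  qed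
  show ?thesis
  proof (unfold_locales)
    show "?A \<subseteq> carrier G" by auto
    show "x \<otimes> y \<in> ?A" if "x \<in> ?A" "y \<in> ?A" for x y
      using that comm[of x y] by (simp add: pow_mult_distrib)
    show "inv x \<in> ?A" if "x \<in> ?A" for x using that by (simp add: nat_pow_inv)
    show "\<one> \<in> ?A" by simp
    show "finite ?A" using fin by simp
    show "x \<otimes> y = y \<otimes> x" if "x \<in> ?A" "y \<in> ?A" for x y using that comm by simp
    show "b \<in> carrier G" by (rule b)
    show "conj_by G (cb x) y \<in> ?A" if "x \<in> ?A" "y \<in> ?A" for x y
      using that norm1[of x y] pow[of "cb x" y] by simp
    show "conj_by G x y \<in> cb ` ?A" if xy: "x \<in> ?A" "y \<in> cb ` ?A" for x y
    proof -
      from xy have "conj_by G x y \<in> cb ` A" by (intro norm2) auto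
      then obtain d where d: "d \<in> A" "conj_by G x y = cb d" by blast
      from xy(2) obtain c where c: "c \<in> ?A" "y = cb c" by blast
      have "y [^] k = \<one>" "y \<in> carrier G" using c pow[of b c] b by auto
      then have "cb d [^] k = \<one>" unfolding d(2)[symmetric] using pow[of x y] xy(1) by simp
      then have "d \<in> ?A" using pow'[of d] d(1) by simp
      then show ?thesis using d(2) by blast
    qed
    show "cb x \<in> ?A" if x: "x \<in> ?A" "x \<in> cb ` ?A" for x
    proof -
      have "cb x \<in> A" using x by (intro inv_I) auto
      then show ?thesis using x pow[of b x] b by simp
    qed
  qed
qed

text \<open>The construction applied to the k-torsion of \<open>A\<close> yields a subgroup of
  \<open>U\<close> of the same order as that torsion, and \<open>U_pow\<close> shows that
  \<open>k\<close> annihilates it.\<close>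

lemma card_torsion_U:
  assumes "odd k"
  shows "card {x \<in> A. x [^] k = \<one>} \<le> card {x \<in> U. x [^] (k::nat) = \<one>}"
proof -
  interpret T: conj_pair G "{x \<in> A. x [^] k = \<one>}" b by (rule conj_pair_torsion)
  have "T.U \<subseteq> {x \<in> U. x [^] k = \<one>}"
  proof
    fix x assume x: "x \<in> T.U"
    then have "x \<in> U" unfolding T.U_def U_def T.I_def I_def by blast
    moreover have "x [^] k = \<one>" using T.U_pow[OF assms _ x] by simp
    ultimately show "x \<in> {x \<in> U. x [^] k = \<one>}" by simp
  qed
  moreover have "finite U" using card_U A.one_closed fin by (metis card.infinite card_gt_0_iff empty_iff)
  ultimately have "card T.U \<le> card {x \<in> U. x [^] k = \<one>}" by (intro card_mono) auto
  then show ?thesis by (simp only: T.card_U)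
qed

end

section \<open>One replacement step\<close>

context group begin

lemma normal_inv_mult_conj:
  assumes "B \<lhd> G" "b \<in> B" "a \<in> carrier G"
  shows "inv a \<otimes> conj_by G b a \<in> B"
proof -
  interpret B: normal B G by fact
  have "inv a \<otimes> conj_by G b a = (inv a \<otimes> b \<otimes> a) \<otimes> inv b"
    using assms(2,3) by (simp add: conj_by_def m_assoc)
  also have "\<dots> \<in> B" using B.inv_op_closed1[OF assms(3,2)] assms(2) by simp
  finally show ?thesis .
qed

text \<open>Conjugating \<open>x\<close> by \<open>inv b\<close> changes it by an element of [B, B],
  which is in \<open>A\<close>.\<close>

lemma mem_conj_image_of_derived:
  assumes B: "subgroup B G" and A: "subgroup A G" and W: "derived G B \<subseteq> A"
    and "b \<in> B" "x \<in> A" "x \<in> B"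
  shows "x \<in> conj_by G b ` A"
proof -
  interpret A: subgroup A G by (rule A)
  interpret B: subgroup B G by (rule B)
  have c: "b \<in> carrier G" "x \<in> carrier G" using assms by simp_all
  have "inv b \<otimes> x \<otimes> inv (inv b) \<otimes> inv x \<in> A"
    using W derived_commutator[of "inv b" B x] assms(4,6) by auto
  then have "inv b \<otimes> x \<otimes> inv (inv b) \<otimes> inv x \<otimes> x \<in> A" using assms(5) by (rule A.m_closed)
  then have "inv b \<otimes> x \<otimes> b \<in> A" using c by (simp add: m_assoc)
  moreover have "x = conj_by G b (inv b \<otimes> x \<otimes> b)"
    using c by (simp add: conj_by_def m_assoc)
  ultimately show ?thesis by blast
qed

lemma conj_by_eq_if_commute:
  assumes "w \<otimes> b = b \<otimes> w" "w \<in> carrier G" "b \<in> carrier G"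
  shows "conj_by G b w = w"
  using assms by (simp add: conj_by_def assms(1)[symmetric] m_assoc)

text \<open>The new subgroup is \<open>U\<close>. Strict growth of the intersection with
  \<open>B\<close> contradicts a maximal choice; order, torsion counts and annihilating p-powers are
  the data by which membership in the families is carried over.\<close>

lemma abelian_replacement:
  assumes p: "Factorial_Ring.prime p" "odd p" "order G = p ^ n"
    and B: "B \<lhd> G" and nil: "nilpotency_class_le G B 2"
    and A: "subgroup A G" and comm: "\<And>x y. x \<in> A \<Longrightarrow> y \<in> A \<Longrightarrow> x \<otimes> y = y \<otimes> x"
    and W: "derived G B \<subseteq> A"
    and nB: "\<not> (\<forall>b\<in>B. conj_by G b ` A = A)"
  obtains A' where "subgroup A' G" "\<And>x y. x \<in> A' \<Longrightarrow> y \<in> A' \<Longrightarrow> x \<otimes> y = y \<otimes> x"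
    "A \<inter> B \<subset> A' \<inter> B" "\<not> B \<subseteq> A'" "card A' = card A"
    "\<And>D. D \<lhd> G \<Longrightarrow> A \<subseteq> D \<Longrightarrow> A' \<subseteq> D"
    "\<And>i. card {x \<in> A. x [^] (p ^ i) = \<one>} \<le> card {x \<in> A'. x [^] (p ^ i) = \<one>}"
    "\<And>i x. \<forall>y\<in>A. y [^] (p ^ i) = \<one> \<Longrightarrow> x \<in> A' \<Longrightarrow> x [^] (p ^ i) = \<one>"
proof -
  interpret A: subgroup A G by (rule A)
  interpret B: normal B G by (rule B)
  have fin: "finite (carrier G)"
    using p order_gt_0_iff_finite by (metis prime_gt_0_nat zero_less_power)
  have finA: "finite A" using finite_subset[OF A.subset fin] .
  obtain M b where M: "M \<lhd> G" "\<And>m. m \<in> M \<Longrightarrow> conj_by G m ` A = A"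
    and b: "b \<in> B" "conj_by G b ` A \<noteq> A"
    and bM: "\<And>g. g \<in> carrier G \<Longrightarrow> conj_by G g b \<otimes> inv b \<in> M"
    using exists_almost_normalizing[OF p(1,3) B A.subset nB] by metis
  interpret M: normal M G by (rule M)
  have bc: "b \<in> carrier G" using b(1) by simp
  have Mm: "conj_by G m y \<in> A" if "m \<in> M" "y \<in> A" for m y
    using M(2)[OF that(1)] that(2) by blast
  have Am: "conj_by G x y \<in> A" if "x \<in> A" "y \<in> A" for x y
    using that by (simp add: conj_by_def)
  \<comment> \<open>An injective conjugation of the finite \<open>A\<close> into itself would be
    onto, so some conjugate leaves \<open>A\<close>.\<close>
  obtain a0 where a0: "a0 \<in> A" "conj_by G b a0 \<notin> A"
  proof -
    have "\<not> conj_by G b ` A \<subseteq> A"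
    proof
      assume "conj_by G b ` A \<subseteq> A"
      moreover have "card (conj_by G b ` A) = card A"
        using conj_by_inj[OF bc] A.subset by (intro card_image) (rule inj_on_subset)
      ultimately show False using card_subset_eq[OF finA] b(2) by metis
    qed
    then show ?thesis using that by blast
  qed
  have twist: "\<exists>w\<in>derived G B. conj_by G b (conj_by G b a) = conj_by G b a \<otimes> inv a \<otimes> conj_by G b a \<otimes> w"
    if "a \<in> A" for a
    by (rule conj_conj_class_two[OF B nil b(1) A.mem_carrier[OF that]])
  interpret cp: conj_pair G A b
  proof (unfold_locales)
    show "finite A" by (rule finA)
    show "x \<otimes> y = y \<otimes> x" if "x \<in> A" "y \<in> A" for x y by (rule comm[OF that])
    show "b \<in> carrier G" by (rule bc)
    show "conj_by G (conj_by G b x) y \<in> A" if xy: "x \<in> A" "y \<in> A" for x y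
    proof -
      \<comment> \<open>Chosen so that \<open>conj_by G b x = m \<otimes> x\<close>, a product of
        two elements normalizing \<open>A\<close>.\<close>
      define m where "m = inv (conj_by G x b \<otimes> inv b)"
      have m: "m \<in> M" unfolding m_def using bM[of x] xy by simp
      have c: "x \<in> carrier G" "y \<in> carrier G" "m \<in> carrier G" using xy m by simp_all
      have "conj_by G b x = m \<otimes> x"
        using bc c(1,2) by (simp add: m_def conj_by_def inv_mult_group m_assoc)
      then have "conj_by G (conj_by G b x) y = conj_by G m (conj_by G x y)"
        using c by (simp add: conj_by_conj_by)
      then show ?thesis using Mm[OF m] Am xy by simp
    qed
    show "conj_by G x y \<in> conj_by G b ` A" if xy: "x \<in> A" "y \<in> conj_by G b ` A" for x y
    proof -
      from xy(2) obtain c where c: "c \<in> A" "y = conj_by G b c" by blast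
      \<comment> \<open>Chosen so that \<open>x \<otimes> b = b \<otimes> m \<otimes> x\<close>,
        which moves the conjugation by \<open>b\<close> outermost.\<close>
      define m where "m = inv b \<otimes> (conj_by G x b \<otimes> inv b) \<otimes> b"
      have m: "m \<in> M" unfolding m_def using M.inv_op_closed1[OF bc] bM[of x] xy(1) by simp
      have k: "x \<in> carrier G" "c \<in> carrier G" "m \<in> carrier G" using xy c m by simp_all
      have "b \<otimes> (m \<otimes> x) = x \<otimes> b"
        using bc k(1,2) by (simp add: m_def conj_by_def m_assoc)
      then have "conj_by G x y = conj_by G b (conj_by G m (conj_by G x c))"
        using k bc by (simp add: c(2) conj_by_conj_by)
      then show ?thesis using Mm[OF m] Am xy(1) c(1) by simp
    qed
    \<comment> \<open>Writing \<open>x\<close> as a conjugate of \<open>c\<close>,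
      \<open>twist\<close> expresses the next conjugate through \<open>x\<close>, \<open>c\<close>
      and an element of [B, B], all in \<open>A\<close>.\<close>
    show "conj_by G b x \<in> A" if x: "x \<in> A" "x \<in> conj_by G b ` A" for x
    proof -
      from x(2) obtain c where c: "c \<in> A" "x = conj_by G b c" by blast
      obtain w where "w \<in> derived G B" "conj_by G b x = x \<otimes> inv c \<otimes> x \<otimes> w"
        using twist[OF c(1)] unfolding c(2) by blast
      then show ?thesis using x(1) c(1) W by auto
    qed
  qed
  have sq: "q = \<one>" if q: "q \<in> carrier G" "q \<otimes> q = \<one>" for q
  proof -
    have "q [^] (2::nat) = \<one>" using q by (simp add: numeral_2_eq_2)
    then have "ord q dvd 2" using q(1) pow_eq_id by blast
    moreover have "ord q dvd p ^ n" using ord_dvd_group_order[OF q(1)] p(3) by simp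
    ultimately have "ord q dvd 1" using p(2) by (metis coprime_common_divisor coprime_left_2_iff_odd even_power is_unit_gcd dvd_refl)
    then show ?thesis using q(1) ord_eq_1 by simp
  qed
  have quotB: "cp.quot a \<in> B" if "a \<in> A" for a
    unfolding cp.quot_def by (rule normal_inv_mult_conj[OF B b(1) A.mem_carrier[OF that]])
  have quot_comm: "cp.quot a \<otimes> cp.quot c = cp.quot c \<otimes> cp.quot a" if "a \<in> A" "c \<in> A" for a c
  proof (rule cp.quot_commute[of "derived G B"])
    show "w \<in> A \<and> conj_by G b w = w" if "w \<in> derived G B" for w
    proof -
      have "w \<in> A" using that W by blast
      moreover from this have "conj_by G b w = w"
        by (intro conj_by_eq_if_commute[OF class_two_commute[OF B.subgroup_axioms nil that b(1)]])
           (auto intro: bc)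
      ultimately show ?thesis by blast
    qed
    show "cp.quot a \<otimes> cp.quot c \<otimes> inv (cp.quot a) \<otimes> inv (cp.quot c) \<in> derived G B"
      if "a \<in> A" "c \<in> A" for a c
      using that by (intro derived_commutator quotB)
  qed (use sq twist that in blast)+
  have ABI: "x \<in> cp.I" if "x \<in> A" "x \<in> B" for x
    unfolding cp.I_def
    using mem_conj_image_of_derived[OF B.subgroup_axioms A W b(1) that] that(1) by blast
  show ?thesis
  proof (rule that[of cp.U])
    show "subgroup cp.U G" by (rule cp.U_subgroup)
    show "x \<otimes> y = y \<otimes> x" if "x \<in> cp.U" "y \<in> cp.U" for x y
      by (rule cp.U_commute[OF quot_comm that])
    \<comment> \<open>\<open>quot a0\<close> is the element gained: it is in \<open>U\<close> and
      \<open>B\<close> but not in \<open>A\<close>, as otherwise the conjugate of \<open>a0\<close>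
      would be in \<open>A\<close>.\<close>
    have "cp.quot a0 \<notin> A"
    proof
      assume "cp.quot a0 \<in> A"
      then have "a0 \<otimes> cp.quot a0 \<in> A" using a0(1) by simp
      then show False using a0 bc by (simp add: cp.quot_def)
    qed
    then show "A \<inter> B \<subset> cp.U \<inter> B"
      using ABI cp.I_U cp.quot_U[OF a0(1)] quotB[OF a0(1)] by blast
    \<comment> \<open>\<open>b\<close> itself is outside \<open>U\<close>, since it moves
      \<open>a0\<close> out of \<open>A\<close>.\<close>
    show "\<not> B \<subseteq> cp.U" using cp.U_normalizes[of b a0] a0 b(1) by blast
    show "card cp.U = card A" by (rule cp.card_U)
    show "cp.U \<subseteq> D" if D: "D \<lhd> G" "A \<subseteq> D" for D
    proof
      interpret D: normal D G by (rule D)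
      fix x assume "x \<in> cp.U"
      then obtain z a where z: "z \<in> cp.I" "a \<in> A" "x = z \<otimes> (inv a \<otimes> conj_by G b a)"
        unfolding cp.U_def cp.quot_def by blast
      have "z \<in> D" "a \<in> D" using z D(2) cp.I_A by auto
      then show "x \<in> D" using D.inv_op_closed2[OF bc] by (simp add: z(3) conj_by_def)
    qed
    show "card {x \<in> A. x [^] (p ^ i) = \<one>} \<le> card {x \<in> cp.U. x [^] (p ^ i) = \<one>}" for i
      using p(2) by (intro cp.card_torsion_U) simp
    show "x [^] (p ^ i) = \<one>" if "\<forall>y\<in>A. y [^] (p ^ i) = \<one>" "x \<in> cp.U" for i x
      by (rule cp.U_pow[OF _ _ that(2)]) (use p(2) that(1) in auto)
  qed
qed

end

section \<open>Rank of abelian p-groups\<close>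

context comm_group begin

lemma pow_image_subgroup: "subgroup ((\<lambda>x. x [^] (k::nat)) ` carrier G) G"
proof (rule subgroupI)
  show "inv x \<in> (\<lambda>x. x [^] k) ` carrier G" if "x \<in> (\<lambda>x. x [^] k) ` carrier G" for x
    using that by (auto simp: nat_pow_inv[symmetric])
  show "x \<otimes> y \<in> (\<lambda>x. x [^] k) ` carrier G"
    if "x \<in> (\<lambda>x. x [^] k) ` carrier G" "y \<in> (\<lambda>x. x [^] k) ` carrier G" for x y
    using that by (auto simp: nat_pow_distrib[symmetric])
qed auto

lemma order_eq_torsion_times_powers:
  assumes fin: "finite (carrier G)"
  shows "order G = card {x \<in> carrier G. x [^] (k::nat) = \<one>} * card ((\<lambda>x. x [^] k) ` carrier G)"
  unfolding order_def
proof (rule card_eq_fibres[OF fin])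
  let ?T = "{x \<in> carrier G. x [^] k = \<one>}"
  fix y assume "y \<in> (\<lambda>x. x [^] k) ` carrier G"
  then obtain x0 where x0: "x0 \<in> carrier G" "y = x0 [^] k" by blast
  have "{x \<in> carrier G. x [^] k = y} = (\<lambda>t. t \<otimes> x0) ` ?T"
  proof (intro equalityI subsetI)
    fix x assume x: "x \<in> {x \<in> carrier G. x [^] k = y}"
    then have "x \<otimes> inv x0 \<in> ?T" using x0 by (simp add: nat_pow_distrib nat_pow_inv)
    moreover have "x = x \<otimes> inv x0 \<otimes> x0" using x x0 by (simp add: m_assoc)
    ultimately show "x \<in> (\<lambda>t. t \<otimes> x0) ` ?T" by blast
  qed (use x0 in \<open>auto simp: nat_pow_distrib\<close>)
  moreover have "inj_on (\<lambda>t. t \<otimes> x0) ?T" using x0 by (auto intro: inj_onI)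
  ultimately show "card {x \<in> carrier G. x [^] k = y} = card ?T" by (simp add: card_image)
qed

text \<open>The products of a power of \<open>y\<close> with an element of \<open>M\<close> form a
  subgroup, and exponents of \<open>y\<close> matter only modulo \<open>p\<close>.\<close>

lemma card_generate_insert_le:
  assumes fin: "finite (carrier G)" and M: "subgroup M G" and y: "y \<in> carrier G"
    and yp: "y [^] p \<in> M" and p: "p > (0::nat)"
  shows "card (generate G (insert y M)) \<le> p * card M"
proof -
  interpret M: subgroup M G by (rule M)
  define V where "V = {y [^] (k::nat) \<otimes> m | k m. m \<in> M}"
  have ykp: "y [^] (p * k) \<in> M" for k
    using yp by (induction k) (simp_all add: y flip: nat_pow_mult)
  have "subgroup V G"
  proof (rule subgroupI)
    show "V \<subseteq> carrier G" unfolding V_def using y by auto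
    show "V \<noteq> {}" unfolding V_def using M.one_closed by blast
    show "u \<otimes> v \<in> V" if uv: "u \<in> V" "v \<in> V" for u v
    proof -
      from uv obtain j m k m' where u: "m \<in> M" "m' \<in> M" "u = y [^] (j::nat) \<otimes> m" "v = y [^] (k::nat) \<otimes> m'"
        unfolding V_def by blast
      have "u \<otimes> v = y [^] (j + k) \<otimes> (m \<otimes> m')"
        using u y by (simp add: m_ac flip: nat_pow_mult)
      then show ?thesis unfolding V_def using u M.m_closed by blast
    qed
    show "inv u \<in> V" if uV: "u \<in> V" for u
    proof -
      from uV obtain j m where u: "m \<in> M" "u = y [^] (j::nat) \<otimes> m"
        unfolding V_def by blast
      \<comment> \<open>Prepares inverses without negative exponents: the inverse of
        \<open>y [^] j\<close> is \<open>y [^] ((p - 1) * j)\<close> up to an element of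
        \<open>M\<close>.\<close>
      have "(p - 1) * j + j = p * j" using p by (cases p) simp_all
      then have "y [^] (p * j) = y [^] ((p - 1) * j) \<otimes> y [^] j"
        using nat_pow_mult[OF y] by simp
      moreover have "inv (y [^] j) = y [^] ((p - 1) * j) \<otimes> inv (y [^] ((p - 1) * j) \<otimes> y [^] j)"
        using y by (simp add: inv_mult)
      ultimately have "inv (y [^] j) = y [^] ((p - 1) * j) \<otimes> inv (y [^] (p * j))"
        by (simp only:)
      then have "inv u = y [^] ((p - 1) * j) \<otimes> (inv (y [^] (p * j)) \<otimes> inv m)"
        using u y by (simp add: inv_mult m_assoc)
      moreover have "inv (y [^] (p * j)) \<otimes> inv m \<in> M" using ykp u by simp
      ultimately show ?thesis unfolding V_def by blast
    qed
  qed
  moreover have "insert y M \<subseteq> V"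
  proof -
    have "y = y [^] (1::nat) \<otimes> \<one>" using y by simp
    moreover have "m = y [^] (0::nat) \<otimes> m" if "m \<in> M" for m using that by simp
    ultimately show ?thesis unfolding V_def using M.one_closed by blast
  qed
  ultimately have "generate G (insert y M) \<subseteq> V" by (intro generate_subgroup_incl)
  also have "V \<subseteq> (\<lambda>(k, m). y [^] k \<otimes> m) ` ({..<p} \<times> M)"
  proof
    fix v assume "v \<in> V"
    then obtain k m where v: "m \<in> M" "v = y [^] (k::nat) \<otimes> m" unfolding V_def by blast
    have "y [^] k = y [^] (k mod p) \<otimes> y [^] (p * (k div p))"
      using y by (simp add: nat_pow_mult)
    then have "v = y [^] (k mod p) \<otimes> (y [^] (p * (k div p)) \<otimes> m)"
      using v y by (simp add: m_assoc)
    moreover have "y [^] (p * (k div p)) \<otimes> m \<in> M" using ykp v by simp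
    ultimately show "v \<in> (\<lambda>(k, m). y [^] k \<otimes> m) ` ({..<p} \<times> M)"
      using p by (intro image_eqI[of _ _ "(k mod p, y [^] (p * (k div p)) \<otimes> m)"]) auto
  qed
  finally have sub: "generate G (insert y M) \<subseteq> (\<lambda>(k, m). y [^] k \<otimes> m) ` ({..<p} \<times> M)" .
  have finM: "finite M" using fin M.subset finite_subset by blast
  have "card (generate G (insert y M)) \<le> card ((\<lambda>(k, m). y [^] k \<otimes> m) ` ({..<p} \<times> M))"
    using finM by (intro card_mono[OF _ sub]) simp
  also have "\<dots> \<le> card ({..<p} \<times> M)" using finM by (intro card_image_le) simp
  finally show ?thesis by (simp add: card_cartesian_product)
qed

text \<open>Each generator enlarges the subgroup by a factor of at most \<open>p\<close>, because
  its p-th power is already there. This bounds the number of generators from below.\<close>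

lemma card_generate_powers_le:
  assumes fin: "finite (carrier G)" and p: "p > (0::nat)" and Y: "finite Y" "Y \<subseteq> carrier G"
  shows "card (generate G (Y \<union> (\<lambda>x. x [^] p) ` carrier G))
           \<le> p ^ card Y * card ((\<lambda>x. x [^] p) ` carrier G)"
  using Y
proof (induction rule: finite_induct)
  case empty
  show ?case
    using generate_subgroup_incl[OF subset_refl pow_image_subgroup[of p]] fin
    by (auto intro!: card_mono)
next
  case (insert y Y)
  let ?Q = "(\<lambda>x. x [^] p) ` carrier G"
  let ?M = "generate G (Y \<union> ?Q)"
  have YQ: "Y \<union> ?Q \<subseteq> carrier G" using insert.prems by auto
  have M: "subgroup ?M G" by (rule generate_is_subgroup[OF YQ])
  have "y [^] p \<in> ?M" using insert.prems by (intro generate.incl) auto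
  then have "card (generate G (insert y ?M)) \<le> p * card ?M"
    using insert.prems p by (intro card_generate_insert_le[OF fin M]) auto
  moreover have "generate G (insert y Y \<union> ?Q) \<subseteq> generate G (insert y ?M)"
    by (rule mono_generate) (auto intro: generate.incl)
  moreover have "finite (generate G (insert y ?M))"
    using generate_in_carrier[of "insert y ?M"] subgroup.subset[OF M] insert.prems fin
    by (intro finite_subset[OF _ fin]) blast
  ultimately have "card (generate G (insert y Y \<union> ?Q)) \<le> p * card ?M"
    by (meson card_mono le_trans)
  also have "\<dots> \<le> p * (p ^ card Y * card ?Q)" using insert by simp
  finally show ?case using insert by simp
qed

text \<open>Greedy choice: an element outside \<open>M\<close> enlarges it at least
  \<open>p\<close>-fold, since all subgroup orders are powers of \<open>p\<close>. This bounds the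
  number of generators from above.\<close>

lemma exists_small_complement_generators:
  assumes p: "Factorial_Ring.prime p" "order G = p ^ n" and M: "subgroup M G"
  shows "\<exists>Y\<subseteq>carrier G. finite Y \<and> generate G (Y \<union> M) = carrier G \<and> p ^ card Y * card M \<le> order G"
  using M
proof (induction "order G - card M" arbitrary: M rule: less_induct)
  case less
  interpret M: subgroup M G by (rule less.prems)
  have fin: "finite (carrier G)"
    using p order_gt_0_iff_finite by (metis prime_gt_0_nat zero_less_power)
  show ?case
  proof (cases "M = carrier G")
    case True
    then have "generate G ({} \<union> M) = carrier G" by (auto intro: generate.incl generate_in_carrier)
    then show ?thesis using True by (intro exI[of _ "{}"]) (simp add: order_def)
  next
    case False
    then obtain y where y: "y \<in> carrier G" "y \<notin> M" using M.subset by blast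
    let ?L = "generate G (insert y M)"
    have yM: "insert y M \<subseteq> carrier G" using y M.subset by blast
    have L: "subgroup ?L G" by (rule generate_is_subgroup[OF yM])
    have M_L: "M \<subset> ?L" using y(2) by (auto intro: generate.incl)
    have finL: "finite ?L" using subgroup.subset[OF L] fin finite_subset by blast
    have lt: "card M < card ?L" by (rule psubset_card_mono[OF finL M_L])
    have Lo: "card ?L \<le> order G" unfolding order_def by (rule card_mono[OF fin subgroup.subset[OF L]])
    have "p * card M \<le> card ?L"
    proof -
      have "card M dvd p ^ n" "card ?L dvd p ^ n"
        using lagrange[OF M.subgroup_axioms] lagrange[OF L] p(2) by (metis dvd_triv_right)+
      then obtain i j where ij: "card M = p ^ i" "card ?L = p ^ j"
        using p(1) divides_primepow_nat by metis
      have "i < j" using lt ij p(1) by (metis power_less_imp_less_exp prime_gt_1_nat)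
      then have "p ^ Suc i \<le> p ^ j" using p(1) by (intro power_increasing) (auto simp: Suc_le_eq prime_gt_0_nat)
      then show ?thesis using ij by simp
    qed
    moreover obtain Y where Y: "Y \<subseteq> carrier G" "finite Y" "generate G (Y \<union> ?L) = carrier G" "p ^ card Y * card ?L \<le> order G"
      using less.hyps[OF _ L] lt Lo by (meson diff_less_mono2 less_le_trans)
    moreover have "generate G (Y \<union> ?L) \<subseteq> generate G (insert y Y \<union> M)"
    proof (rule generate_subgroup_incl)
      show sub: "subgroup (generate G (insert y Y \<union> M)) G"
        using Y(1) yM by (intro generate_is_subgroup) auto
      have "?L \<subseteq> generate G (insert y Y \<union> M)" by (rule mono_generate) auto
      then show "Y \<union> ?L \<subseteq> generate G (insert y Y \<union> M)" by (auto intro: generate.incl)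
    qed
    moreover have "generate G (insert y Y \<union> M) \<subseteq> carrier G"
      using Y(1) yM generate_in_carrier[of "insert y Y \<union> M"] by blast
    moreover have "p ^ card (insert y Y) * card M \<le> order G"
    proof -
      \<comment> \<open>Only an inequality is claimed, as \<open>Y\<close> may already contain
        \<open>y\<close>.\<close>
      have "p ^ card (insert y Y) \<le> p ^ Suc (card Y)"
        using p(1)
        by (intro power_increasing) (auto simp: Suc_le_eq prime_gt_0_nat card_insert_if Y(2))
      then have "p ^ card (insert y Y) * card M \<le> p ^ card Y * (p * card M)" by (simp add: mult.assoc mult.commute mult.left_commute)
      also have "\<dots> \<le> p ^ card Y * card ?L" using \<open>p * card M \<le> card ?L\<close> by simp
      finally show ?thesis using Y(4) by simp
    qed
    ultimately show ?thesis using y(1) by (intro exI[of _ "insert y Y"]) auto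
  qed
qed

text \<open>The \<open>p\<close>-th powers are non-generators: iterating \<open>G = \<langle>Y\<rangle> G\<^sup>p\<close> gives \<open>G = \<langle>Y\<rangle> G\<^bsup>p^n\<^esup> = \<langle>Y\<rangle>\<close>.\<close>

lemma generate_mod_powers:
  assumes G: "order G = p ^ n" and Y: "Y \<subseteq> carrier G"
    and gen: "generate G (Y \<union> (\<lambda>x. x [^] (p::nat)) ` carrier G) = carrier G"
  shows "generate G Y = carrier G"
proof -
  let ?H = "generate G Y"
  define V where "V = {h \<otimes> c [^] p | h c. h \<in> ?H \<and> c \<in> carrier G}"
  interpret H: subgroup ?H G by (rule generate_is_subgroup[OF Y])
  have VI: "h \<otimes> c [^] p \<in> V" if "h \<in> ?H" "c \<in> carrier G" for h c
    using that unfolding V_def by blast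
  have "subgroup V G"
  proof (rule subgroupI)
    show "V \<subseteq> carrier G" unfolding V_def by auto
    show "V \<noteq> {}" using VI[OF H.one_closed one_closed] by blast
    show "inv u \<in> V" if "u \<in> V" for u
    proof -
      from that obtain h c where u: "h \<in> ?H" "c \<in> carrier G" "u = h \<otimes> c [^] p" unfolding V_def by blast
      have hc: "h \<in> carrier G" using u(1) by (rule H.mem_carrier)
      have "inv u = inv h \<otimes> (inv c) [^] p" using u(2,3) hc by (simp add: inv_mult nat_pow_inv)
      then show ?thesis using VI[of "inv h" "inv c"] u by simp
    qed
    show "u \<otimes> v \<in> V" if uv: "u \<in> V" "v \<in> V" for u v
    proof -
      from uv obtain h c h' c' where u: "h \<in> ?H" "c \<in> carrier G" "u = h \<otimes> c [^] p"
        "h' \<in> ?H" "c' \<in> carrier G" "v = h' \<otimes> c' [^] p" unfolding V_def by blast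
      have hc: "h \<in> carrier G" "h' \<in> carrier G" using u by (auto intro: H.mem_carrier)
      have "u \<otimes> v = (h \<otimes> h') \<otimes> (c \<otimes> c') [^] p"
        using u(2,3,5,6) hc by (simp add: nat_pow_distrib m_ac)
      then show ?thesis using VI[of "h \<otimes> h'" "c \<otimes> c'"] u by simp
    qed
  qed
  moreover have "Y \<union> (\<lambda>x. x [^] p) ` carrier G \<subseteq> V"
  proof -
    have "y \<in> V" if "y \<in> Y" for y
      using VI[OF generate.incl[OF that] one_closed] that Y by (auto simp: subset_iff)
    moreover have "x [^] p \<in> V" if "x \<in> carrier G" for x
      using VI[OF H.one_closed that] that by simp
    ultimately show ?thesis by blast
  qed
  ultimately have "carrier G \<subseteq> V" using generate_subgroup_incl gen by metis
  then have step: "\<exists>h\<in>?H. \<exists>c\<in>carrier G. x = h \<otimes> c [^] p" if "x \<in> carrier G" for x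
    using that unfolding V_def by blast
  have iter: "\<exists>h\<in>?H. \<exists>c\<in>carrier G. x = h \<otimes> c [^] (p ^ k)" if "x \<in> carrier G" for x k
  proof (induction k)
    case 0
    show ?case by (rule bexI[OF bexI[OF _ that] H.one_closed]) (use that in simp)
  next
    case (Suc k)
    then obtain h c where hc: "h \<in> ?H" "c \<in> carrier G" "x = h \<otimes> c [^] (p ^ k)" by blast
    from step[OF hc(2)] obtain h' d where d: "h' \<in> ?H" "d \<in> carrier G" "c = h' \<otimes> d [^] p" by blast
    have car: "h \<in> carrier G" "h' \<in> carrier G" using hc d by (auto intro: H.mem_carrier)
    have "h' [^] k \<in> ?H" for k :: nat by (induction k) (use d in auto)
    then have "h \<otimes> h' [^] (p ^ k) \<in> ?H" using hc(1) by simp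
    moreover have "x = h \<otimes> h' [^] (p ^ k) \<otimes> d [^] (p ^ Suc k)"
      unfolding hc(3) d(3) using car d(2) by (simp add: nat_pow_distrib nat_pow_pow m_assoc)
    ultimately show ?case using d(2) by blast
  qed
  have "x \<in> ?H" if x: "x \<in> carrier G" for x
  proof -
    obtain h c where hc: "h \<in> ?H" "c \<in> carrier G" "x = h \<otimes> c [^] (p ^ n)"
      using iter[OF x]
      by blast
    moreover have "c [^] (p ^ n) = \<one>" using pow_order_eq_1[OF hc(2)] G by simp
    ultimately show ?thesis using H.mem_carrier[OF hc(1)] by simp
  qed
  then show ?thesis using H.subset by blast
qed

text \<open>The p-th powers are non-generators, so both counting bounds identify the left side with
  the index of the subgroup of p-th powers; by kernel and image of the power map, that is the size
  of the p-torsion. Ranks thus become torsion counts.\<close>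

lemma min_generators_torsion:
  assumes p: "Factorial_Ring.prime p" "order G = p ^ n"
  shows "p ^ min_generators G (carrier G) = card {x \<in> carrier G. x [^] p = \<one>}"
proof -
  let ?T = "{x \<in> carrier G. x [^] p = \<one>}" and ?Q = "(\<lambda>x. x [^] p) ` carrier G"
  let ?P = "\<lambda>n. \<exists>Y. Y \<subseteq> carrier G \<and> finite Y \<and> card Y = n \<and> generate G Y = carrier G"
  have fin: "finite (carrier G)"
    using p order_gt_0_iff_finite by (metis prime_gt_0_nat zero_less_power)
  have o: "order G = card ?T * card ?Q" by (rule order_eq_torsion_times_powers[OF fin])
  have Q0: "card ?Q > 0" using fin by (auto simp: card_gt_0_iff)
  obtain Y where Y: "Y \<subseteq> carrier G" "finite Y" "generate G (Y \<union> ?Q) = carrier G"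
    "p ^ card Y * card ?Q \<le> order G"
    using exists_small_complement_generators[OF p pow_image_subgroup[of p]] by blast
  have PY: "?P (card Y)" using Y generate_mod_powers[OF p(2) Y(1,3)] by blast
  have "min_generators G (carrier G) \<le> card Y"
    unfolding min_generators_def by (rule Least_le[of ?P, OF PY])
  then have "p ^ min_generators G (carrier G) \<le> p ^ card Y"
    using p(1) by (intro power_increasing) (auto simp: Suc_le_eq prime_gt_0_nat)
  also have "\<dots> \<le> card ?T" using Y(4) Q0 unfolding o by simp
  finally have le: "p ^ min_generators G (carrier G) \<le> card ?T" .
  have "?P (min_generators G (carrier G))"
    unfolding min_generators_def by (rule LeastI[of ?P, OF PY])
  then obtain Z where Z: "Z \<subseteq> carrier G" "finite Z" "card Z = min_generators G (carrier G)"
    "generate G Z = carrier G" by blast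
  have "carrier G \<subseteq> generate G (Z \<union> ?Q)" using mono_generate[of Z "Z \<union> ?Q"] Z(4) by blast
  moreover have "generate G (Z \<union> ?Q) \<subseteq> carrier G"
    using generate_in_carrier[of "Z \<union> ?Q"] Z(1) by auto
  ultimately have "order G \<le> p ^ card Z * card ?Q"
    using card_generate_powers_le[OF fin _ Z(2,1), of p] p(1) unfolding order_def
    by (simp add: prime_gt_0_nat subset_antisym)
  then have "card ?T \<le> p ^ min_generators G (carrier G)" unfolding o Z(3) using Q0 by simp
  with le show ?thesis by simp
qed

end

section \<open>The replacement property\<close>

context group begin

lemma mem_abelian_subgroups_iff:
  assumes "subgroup D G"
  shows "A \<in> abelian_subgroups G D \<longleftrightarrow>
    subgroup A G \<and> A \<subseteq> D \<and> (\<forall>x\<in>A. \<forall>y\<in>A. x \<otimes> y = y \<otimes> x)"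
proof -
  have "subgroup A (G\<lparr>carrier := D\<rparr>) \<longleftrightarrow> subgroup A G \<and> A \<subseteq> D"
    using incl_subgroup[OF assms] subgroup_incl[OF _ assms] subgroup.subset[of A "G\<lparr>carrier := D\<rparr>"]
    by auto
  moreover have "comm_group (G\<lparr>carrier := A\<rparr>) \<longleftrightarrow> (\<forall>x\<in>A. \<forall>y\<in>A. x \<otimes> y = y \<otimes> x)"
    if "subgroup A G"
  proof
    assume "comm_group (G\<lparr>carrier := A\<rparr>)"
    then interpret C: comm_group "G\<lparr>carrier := A\<rparr>" .
    show "\<forall>x\<in>A. \<forall>y\<in>A. x \<otimes> y = y \<otimes> x" using C.m_comm by simp
  next
    assume "\<forall>x\<in>A. \<forall>y\<in>A. x \<otimes> y = y \<otimes> x"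
    then show "comm_group (G\<lparr>carrier := A\<rparr>)"
      using group.group_comm_groupI[OF subgroup_imp_group[OF that]] by simp
  qed
  ultimately show ?thesis unfolding abelian_subgroups_def by auto
qed

lemma abelian_subgroupsD:
  assumes "subgroup D G" "A \<in> abelian_subgroups G D"
  shows "subgroup A G" "A \<subseteq> D" "\<And>x y. x \<in> A \<Longrightarrow> y \<in> A \<Longrightarrow> x \<otimes> y = y \<otimes> x"
  using assms(2) by (simp_all add: mem_abelian_subgroups_iff[OF assms(1)])

lemma torsion_subgroup:
  assumes "subgroup A G" "\<And>x y. x \<in> A \<Longrightarrow> y \<in> A \<Longrightarrow> x \<otimes> y = y \<otimes> x"
  shows "subgroup {x \<in> A. x [^] (k::nat) = \<one>} G"
proof -
  interpret A: subgroup A G by fact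
  show ?thesis
  proof (rule subgroupI)
    show "{x \<in> A. x [^] k = \<one>} \<noteq> {}" using A.one_closed nat_pow_one by blast
    show "inv x \<in> {x \<in> A. x [^] k = \<one>}" if "x \<in> {x \<in> A. x [^] k = \<one>}" for x
      using that by (simp add: nat_pow_inv)
    show "x \<otimes> y \<in> {x \<in> A. x [^] k = \<one>}"
      if "x \<in> {x \<in> A. x [^] k = \<one>}" "y \<in> {x \<in> A. x [^] k = \<one>}" for x y
      using that assms(2)[of x y] by (simp add: pow_mult_distrib)
  qed auto
qed

text \<open>Element orders are powers of \<open>p\<close>, for which comparison in size and
  divisibility agree.\<close>

lemma ord_le_prime_power_iff:
  assumes p: "Factorial_Ring.prime p" "order G = p ^ n" and x: "x \<in> carrier G"
  shows "ord x \<le> p ^ i \<longleftrightarrow> x [^] (p ^ i) = \<one>"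
proof -
  have "ord x dvd p ^ n" using ord_dvd_group_order[OF x] p(2) by simp
  then obtain j where j: "ord x = p ^ j" using p(1) by (auto simp: divides_primepow_nat)
  have "p ^ j \<le> p ^ i \<longleftrightarrow> p ^ j dvd p ^ i"
    using prime_gt_1_nat[OF p(1)] by (metis dvd_power_iff_le power_increasing_iff prime_ge_2_nat p(1))
  then show ?thesis using pow_eq_id[OF x] j by simp
qed

text \<open>In an abelian subgroup the elements generating \<open>Omega\<close> already form a
  subgroup.\<close>

lemma Omega_eq_torsion:
  assumes p: "Factorial_Ring.prime p" "order G = p ^ n"
    and A: "subgroup A G" "\<And>x y. x \<in> A \<Longrightarrow> y \<in> A \<Longrightarrow> x \<otimes> y = y \<otimes> x"
  shows "Omega G p i A = {x \<in> A. x [^] (p ^ i) = \<one>}"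
proof -
  have "{x \<in> A. ord x \<le> p ^ i} = {x \<in> A. x [^] (p ^ i) = \<one>}"
    using ord_le_prime_power_iff[OF p] subgroup.subset[OF A(1)] by blast
  moreover have "generate G {x \<in> A. x [^] (p ^ i) = \<one>} = {x \<in> A. x [^] (p ^ i) = \<one>}"
    using generate_subgroup_incl[OF subset_refl torsion_subgroup[OF A]] by (auto intro: generate.incl)
  ultimately show ?thesis unfolding Omega_def by simp
qed

lemma min_generators_abelian:
  assumes p: "Factorial_Ring.prime p" "order G = p ^ n"
    and A: "subgroup A G" "\<And>x y. x \<in> A \<Longrightarrow> y \<in> A \<Longrightarrow> x \<otimes> y = y \<otimes> x"
  shows "p ^ min_generators G A = card {x \<in> A. x [^] p = \<one>}"
proof -
  interpret C: comm_group "G\<lparr>carrier := A\<rparr>"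
    using group.group_comm_groupI[OF subgroup_imp_group[OF A(1)]] A(2) by simp
  have "card A dvd p ^ n" using lagrange[OF A(1)] p(2) by (metis dvd_triv_right)
  then obtain m where m: "order (G\<lparr>carrier := A\<rparr>) = p ^ m"
    using p(1) by (auto simp: divides_primepow_nat order_def)
  have gen: "generate (G\<lparr>carrier := A\<rparr>) Y = generate G Y" if "Y \<subseteq> A" for Y
    using generate_consistent[OF that A(1)] .
  have "(Y \<subseteq> A \<and> finite Y \<and> card Y = k \<and> generate (G\<lparr>carrier := A\<rparr>) Y = A) \<longleftrightarrow>
      (Y \<subseteq> A \<and> finite Y \<and> card Y = k \<and> generate G Y = A)" for Y k
    using gen by auto
  then have "min_generators (G\<lparr>carrier := A\<rparr>) A = min_generators G A"
    unfolding min_generators_def by simp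
  moreover have "x [^]\<^bsub>G\<lparr>carrier := A\<rparr>\<^esub> p = x [^] p" for x
    by (rule nat_pow_consistent[symmetric])
  ultimately show ?thesis using C.min_generators_torsion[OF p(1) m] by simp
qed

text \<open>A member with largest intersection with \<open>B\<close> must be normalized by
  \<open>B\<close>, or \<open>abelian_replacement\<close> gives a better one. Since \<open>D\<close>
  is normal, the new subgroup stays in \<open>D\<close>, and \<open>closed\<close> puts it in the
  family.\<close>

lemma replacement_propertyI:
  assumes p: "Factorial_Ring.prime p" "odd p" "order G = p ^ n" and D: "D \<lhd> G"
    and sub: "\<A> \<subseteq> abelian_subgroups G D"
    and closed: "\<And>A A'. A \<in> \<A> \<Longrightarrow> A' \<in> abelian_subgroups G D \<Longrightarrow> card A' = card A \<Longrightarrow>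
      (\<And>i. card {x \<in> A. x [^] (p ^ i) = \<one>} \<le> card {x \<in> A'. x [^] (p ^ i) = \<one>}) \<Longrightarrow>
      (\<And>i x. \<forall>y\<in>A. y [^] (p ^ i) = \<one> \<Longrightarrow> x \<in> A' \<Longrightarrow> x [^] (p ^ i) = \<one>) \<Longrightarrow> A' \<in> \<A>"
  shows "replacement_property G \<A>"
proof -
  interpret D: normal D G by (rule D)
  note ab = abelian_subgroupsD[OF D.subgroup_axioms]
  have fin: "finite (carrier G)"
    using p order_gt_0_iff_finite by (metis prime_gt_0_nat zero_less_power)
  have "\<exists>A\<in>\<A>. derived G B \<subseteq> A \<and> \<not> B \<subseteq> A \<and> B \<subseteq> normalizer G A"
    if B: "B \<lhd> G" "nilpotency_class_le G B 2" and ex: "\<exists>A\<in>\<A>. derived G B \<subseteq> A \<and> \<not> B \<subseteq> A" for B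
  proof -
    interpret B: normal B G by (rule B(1))
    have WB: "derived G B \<subseteq> B" by (rule derived_incl[OF subset_refl B.subgroup_axioms])
    let ?P = "\<lambda>A. A \<in> \<A> \<and> derived G B \<subseteq> A \<and> \<not> B \<subseteq> A"
    have "card (A \<inter> B) < Suc (order G)" for A
      unfolding order_def less_Suc_eq_le using fin B.subset by (intro card_mono) auto
    then obtain A where A: "?P A" and max: "\<And>A'. ?P A' \<Longrightarrow> card (A' \<inter> B) \<le> card (A \<inter> B)"
      using ex_has_greatest_nat[of ?P _ "\<lambda>A. card (A \<inter> B)" "Suc (order G)"] ex by metis
    note A' = ab[OF subsetD[OF sub conjunct1[OF A]]]
    have WA: "derived G B \<subseteq> A" using A by blast
    have "\<forall>b\<in>B. conj_by G b ` A = A"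
    proof (rule ccontr)
      assume nB: "\<not> ?thesis"
      show False
      proof (rule abelian_replacement[OF p B A'(1) _ WA nB])
        show "x \<otimes> y = y \<otimes> x" if "x \<in> A" "y \<in> A" for x y by (rule A'(3)[OF that])
      next
        fix A1
        assume A1: "subgroup A1 G" "\<And>x y. x \<in> A1 \<Longrightarrow> y \<in> A1 \<Longrightarrow> x \<otimes> y = y \<otimes> x"
          "A \<inter> B \<subset> A1 \<inter> B" "\<not> B \<subseteq> A1" "card A1 = card A"
          "\<And>D. D \<lhd> G \<Longrightarrow> A \<subseteq> D \<Longrightarrow> A1 \<subseteq> D"
          "\<And>i. card {x \<in> A. x [^] (p ^ i) = \<one>} \<le> card {x \<in> A1. x [^] (p ^ i) = \<one>}"
          "\<And>i x. \<forall>y\<in>A. y [^] (p ^ i) = \<one> \<Longrightarrow> x \<in> A1 \<Longrightarrow> x [^] (p ^ i) = \<one>"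
        have "A1 \<in> abelian_subgroups G D"
          using A1(1,2) A1(6)[OF D A'(2)] by (simp add: mem_abelian_subgroups_iff[OF D.subgroup_axioms])
        then have "A1 \<in> \<A>" using conjunct1[OF A] A1(5,7,8) by (intro closed[of A A1])
        \<comment> \<open>[B, B] lies in the intersection of \<open>A\<close> and \<open>B\<close>,
          which the replacement retains.\<close>
        moreover have "derived G B \<subseteq> A1" using A WB A1(3) by blast
        ultimately have "card (A1 \<inter> B) \<le> card (A \<inter> B)" using max A1(4) by blast
        moreover have "finite (A1 \<inter> B)" using fin B.subset finite_subset by blast
        ultimately show False using psubset_card_mono[OF _ A1(3)] by simp
      qed
    qed
    moreover have "b <# A #> inv b = conj_by G b ` A" for b
      by (auto simp: l_coset_def r_coset_def conj_by_def)
    ultimately have "B \<subseteq> normalizer G A"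
      unfolding normalizer_def stabilizer_def using subgroup.subset[OF A'(1)] by auto
    then show ?thesis using A by blast
  qed
  moreover have "\<A> \<subseteq> abelian_subgroups G (carrier G)"
    using sub ab by (auto simp: mem_abelian_subgroups_iff[OF subgroup_self] subgroup.subset)
  ultimately show ?thesis unfolding replacement_property_def by blast
qed

text \<open>The hypothesis concerns p-powers only, so the exponent \<open>e\<close> is first
  replaced by its p-part; this still annihilates \<open>A\<close> because element orders are powers
  of \<open>p\<close>.\<close>

lemma group_exponent_mono:
  assumes p: "Factorial_Ring.prime p" "order G = p ^ n" and A: "A \<subseteq> carrier G" "A' \<subseteq> carrier G"
    and le: "\<And>i x. \<forall>y\<in>A. y [^] (p ^ i) = \<one> \<Longrightarrow> x \<in> A' \<Longrightarrow> x [^] (p ^ i) = \<one>"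
  shows "group_exponent G A' \<le> group_exponent G A"
proof -
  let ?P = "\<lambda>A n. 0 < n \<and> (\<forall>x\<in>A. x [^] n = \<one>)"
  define e where "e = group_exponent G A"
  have "?P A (order G)" using pow_order_eq_1 A(1) p by (auto simp: subset_iff prime_gt_0_nat)
  then have e: "?P A e" unfolding e_def group_exponent_def by (rule LeastI)
  obtain k m where km: "e = m * p ^ k" "\<not> p dvd m"
    using e p(1) prime_power_canonical by metis
  have "y [^] (p ^ k) = \<one>" if "y \<in> A" for y
  proof -
    have yc: "y \<in> carrier G" using that A(1) by blast
    have "y [^] e = \<one>" using e that by blast
    then have "ord y dvd m * p ^ k" using pow_eq_id[OF yc] km(1) by blast
    moreover have "ord y dvd p ^ n" using ord_dvd_group_order[OF yc] p(2) by simp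
    then have "coprime (ord y) m"
      using km(2) p(1) by (metis coprime_commute coprime_divisors coprime_power_left_iff dvd_refl prime_imp_coprime)
    ultimately have "ord y dvd p ^ k" by (simp add: coprime_dvd_mult_right_iff)
    then show ?thesis using pow_eq_id[OF yc] by blast
  qed
  then have "?P A' (p ^ k)" using le p(1) by (simp add: prime_gt_0_nat)
  then have "group_exponent G A' \<le> p ^ k" unfolding group_exponent_def by (rule Least_le)
  also have "\<dots> \<le> e" using km e by auto
  finally show ?thesis unfolding e_def .
qed

end

section \<open>Lexicographic comparison and the six families\<close>

lemma lex_ge_pointwise:
  assumes "\<And>i. t i \<le> s i"
  shows "lex_ge s t"
proof (cases "s = t")
  case False
  then obtain i where "s i \<noteq> t i" by blast
  define k where "k = (LEAST i. s i \<noteq> t i)"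
  have "s k \<noteq> t k" unfolding k_def by (rule LeastI) fact
  moreover have "s i = t i" if "i < k" for i using not_less_Least that unfolding k_def by blast
  ultimately show ?thesis unfolding lex_ge_def using assms[of k] by (intro disjI2 less_funI exI[of _ k]) auto
qed (simp add: lex_ge_def)

lemma lex_ge_trans: "lex_ge s t \<Longrightarrow> lex_ge t u \<Longrightarrow> lex_ge s u"
  unfolding lex_ge_def using less_fun_trans by blast

theorem theorem1p4:
  fixes S :: "('a, 'b) monoid_scheme" and D :: "'a set" and p n :: nat
  assumes "Factorial_Ring.prime p" and "odd p"
    and "group S" and "order S = p ^ n"
    and "D \<lhd> S"
  shows "replacement_property S (A_o S D) \<and>
         replacement_property S (A_r S D) \<and>
         replacement_property S (A_e S p D) \<and>
         replacement_property S (A_lex S p D) \<and>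
         replacement_property S (A_olex S p D) \<and>
         (\<forall>(m :: int) (e :: int) (\<zeta> :: nat \<Rightarrow> int).
            replacement_property S (A_param S p m e \<zeta> D))"
proof -
  interpret group S by fact
  interpret D: normal D S by fact
  note p = assms(1,4)
  note ab = abelian_subgroupsD[OF D.subgroup_axioms]
  note I = replacement_propertyI[OF assms(1,2,4,5)]
  have fin: "finite (carrier S)"
    using p order_gt_0_iff_finite by (metis prime_gt_0_nat zero_less_power)
  let ?T = "\<lambda>A i. {x \<in> A. x [^]\<^bsub>S\<^esub> (p ^ i) = \<one>\<^bsub>S\<^esub>}"
  \<comment> \<open>Collects what one replacement preserves or improves; each family then only has
    to be upward closed under \<open>better\<close>.\<close>
  define better where "better A A' \<longleftrightarrow> A \<in> abelian_subgroups S D \<and> A' \<in> abelian_subgroups S D \<and>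
    card A' = card A \<and> (\<forall>i. card (?T A i) \<le> card (?T A' i)) \<and>
    (\<forall>i. (\<forall>y\<in>A. y [^]\<^bsub>S\<^esub> (p ^ i) = \<one>\<^bsub>S\<^esub>) \<longrightarrow> (\<forall>x\<in>A'. x [^]\<^bsub>S\<^esub> (p ^ i) = \<one>\<^bsub>S\<^esub>))" for A A'
  have main: "replacement_property S \<A>"
    if "\<A> \<subseteq> abelian_subgroups S D" "\<And>A A'. A \<in> \<A> \<Longrightarrow> better A A' \<Longrightarrow> A' \<in> \<A>" for \<A>
    using that(1)
  proof (rule I)
    fix A A'
    assume h: "A \<in> \<A>" "A' \<in> abelian_subgroups S D" "card A' = card A"
      "\<And>i. card (?T A i) \<le> card (?T A' i)"
      "\<And>i x. \<forall>y\<in>A. y [^]\<^bsub>S\<^esub> (p ^ i) = \<one>\<^bsub>S\<^esub> \<Longrightarrow> x \<in> A' \<Longrightarrow> x [^]\<^bsub>S\<^esub> (p ^ i) = \<one>\<^bsub>S\<^esub>"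
    then have "better A A'" unfolding better_def using that(1) by blast
    with h(1) show "A' \<in> \<A>" by (rule that(2))
  qed
  have abD: "A' \<in> abelian_subgroups S D" and abD': "A \<in> abelian_subgroups S D" if "better A A'" for A A'
    using that unfolding better_def by blast+
  have card: "card A' = card A" if "better A A'" for A A'
    using that unfolding better_def by blast
  have Omega: "Omega S p i A = ?T A i" if "A \<in> abelian_subgroups S D" for A i
    by (rule Omega_eq_torsion[OF p ab(1,3)[OF that]])
  have lex: "lex_ge (omega_seq S p A') (omega_seq S p A)" if "better A A'" for A A'
    using that unfolding better_def omega_seq_def
    by (intro lex_ge_pointwise) (simp add: Omega del: power_Suc)
  have expo: "group_exponent S A' \<le> group_exponent S A" if "better A A'" for A A'
  proof (rule group_exponent_mono[OF p])
    show "A \<subseteq> carrier S" "A' \<subseteq> carrier S"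
      using ab(2)[OF abD[OF that]] ab(2)[OF abD'[OF that]] D.subset by blast+
  qed (use that in \<open>auto simp: better_def\<close>)
  have mg: "p ^ min_generators S A = card (?T A 1)" if "A \<in> abelian_subgroups S D" for A
    using min_generators_abelian[OF p ab(1,3)[OF that]] by simp
  have mg_mono: "min_generators S A \<le> min_generators S A'"
    if "A \<in> abelian_subgroups S D" "A' \<in> abelian_subgroups S D" "card (?T A 1) \<le> card (?T A' 1)" for A A'
    using that(3) unfolding mg[OF that(1), symmetric] mg[OF that(2), symmetric]
    by (rule power_le_imp_le_exp[OF prime_gt_1_nat[OF p(1)]])
  have rank_ab: "group_rank S A = min_generators S A" if "A \<in> abelian_subgroups S D" for A
    using that by (simp add: group_rank_def abelian_subgroups_def)
  \<comment> \<open>\<open>group_rank\<close> has two branches: for abelian \<open>D\<close> the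
    bound comes from inclusion of p-torsion, otherwise from the maximum over abelian
    subgroups.\<close>
  have rank_le: "min_generators S A \<le> group_rank S D" if A: "A \<in> abelian_subgroups S D" for A
  proof (cases "comm_group (S\<lparr>carrier := D\<rparr>)")
    case True
    then have D: "D \<in> abelian_subgroups S D"
      unfolding abelian_subgroups_def
      using subgroup_incl[OF D.subgroup_axioms D.subgroup_axioms] by simp
    have "finite D" using fin D.subset finite_subset by blast
    then have "card (?T A 1) \<le> card (?T D 1)" using ab(2)[OF A] by (intro card_mono) auto
    then show ?thesis using mg_mono[OF A D] rank_ab[OF D] by simp
  next
    case False
    have "finite (abelian_subgroups S D)"
      by (rule finite_subset[of _ "Pow D"]) (use ab(2) finite_subset[OF D.subset fin] in auto)
    then show ?thesis using False A by (simp add: group_rank_def)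
  qed
  \<comment> \<open>The rank cannot fall, as the p-torsion count does not, and it cannot exceed the
    rank of \<open>D\<close>, which \<open>A\<close> attains.\<close>
  have r: "A' \<in> A_r S D" if "A \<in> A_r S D" "better A A'" for A A'
  proof -
    have "card (?T A 1) \<le> card (?T A' 1)" using that(2) unfolding better_def by blast
    then have "min_generators S A \<le> min_generators S A'"
      by (rule mg_mono[OF abD'[OF that(2)] abD[OF that(2)]])
    then show ?thesis
      using that(1) abD[OF that(2)] abD'[OF that(2)] rank_ab rank_le[OF abD[OF that(2)]]
      by (simp add: A_r_def)
  qed
  have o: "A' \<in> A_o S D" if "A \<in> A_o S D" "better A A'" for A A'
    using that(1) abD[OF that(2)] card[OF that(2)] by (simp add: A_o_def)
  have "replacement_property S (A_o S D)"
    by (rule main[OF _ o]) (auto simp: A_o_def)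
  moreover have "replacement_property S (A_r S D)"
    by (rule main[OF _ r]) (auto simp: A_r_def)
  moreover have "replacement_property S (A_e S p D)"
  proof (rule main)
    fix A A' assume h: "A \<in> A_e S p D" "better A A'"
    \<comment> \<open>Being elementary abelian is the annihilation condition at exponent
      \<open>p ^ 1\<close>.\<close>
    then have "\<forall>x\<in>A'. x [^]\<^bsub>S\<^esub> (p ^ 1) = \<one>\<^bsub>S\<^esub>"
      unfolding better_def by (auto simp: A_e_def elementary_abelian_def dest: spec[of _ 1])
    moreover have "comm_group (S\<lparr>carrier := A'\<rparr>)"
      using abD[OF h(2)] by (simp add: abelian_subgroups_def)
    ultimately show "A' \<in> A_e S p D"
      using r[OF _ h(2)] h(1) by (simp add: A_e_def elementary_abelian_def)
  qed (auto simp: A_e_def A_r_def)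
  moreover have "replacement_property S (A_lex S p D)"
    by (rule main) (auto simp: A_lex_def abD intro: lex_ge_trans[OF lex])
  moreover have "replacement_property S (A_olex S p D)"
  proof (rule main)
    fix A A' assume "A \<in> A_olex S p D" "better A A'"
    then show "A' \<in> A_olex S p D"
      unfolding A_olex_def using o lex_ge_trans[OF lex] by blast
  qed (auto simp: A_olex_def A_o_def)
  moreover have "replacement_property S (A_param S p m e \<zeta> D)" for m e :: int and \<zeta>
  proof (rule main)
    fix A A' assume h: "A \<in> A_param S p m e \<zeta> D" "better A A'"
    have "real (group_exponent S A') \<le> real (group_exponent S A)" using expo[OF h(2)] by simp
    also have "\<dots> \<le> real p powi e" using h(1) by (simp add: A_param_def)
    finally show "A' \<in> A_param S p m e \<zeta> D"
      using h abD[OF h(2)] card[OF h(2)] lex_ge_trans[OF lex[OF h(2)]] by (simp add: A_param_def)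
  qed (auto simp: A_param_def)
  ultimately show ?thesis by blast
qed

end
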